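(* Let $R$ be a one-dimensional local domain of characteristic $p>0$ with infinite residue field and let $I$ be an ideal of $R$. Then $*\text{-}\operatorname{core}(I)=\operatorname{core}(I)$.
   Context: Local rings are Noetherian. A reduction of $I$ is an ideal $J\subset I$ with $JI^n=I^{n+1}$ for some $n\ge0$; $\operatorname{core}(I)$ is the intersection of all reductions of $I$. Tight closure: $x\in I^*$ iff there is $c\in R^0$ (the elements outside all minimal primes) with $cx^q\in I^{[q]}$ for all large powers $q$ of $p$, where $I^{[q]}$ is generated by the $q$-th powers of elements of $I$. A $*$-reduction of $I$ is an ideal $J$ with $J\subset I\subset J^*$; $*\text{-}\operatorname{core}(I)$ is the intersection of all $*$-reductions of $I$. *)

theory Defs
  imports "HOL-Algebra.Algebra" "HOL-Library.Extended_Nat"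
begin

locale local_ring = cring + noetherian_ring +
  assumes unique_maximal: "\<exists>!m. maximalideal m R"

definition residue_field :: "('a, 'b) ring_scheme \<Rightarrow> 'a set ring"
  where "residue_field R = R Quot (THE m. maximalideal m R)"

text \<open>Supremum of the lengths of strict chains of prime ideals. The supremum is taken in
  \<^typ>\<open>enat\<close>, so the zero ring gets dimension \<open>0\<close>.\<close>

definition krull_dim :: "('a, 'b) ring_scheme \<Rightarrow> enat"
  where "krull_dim R =
    Sup (enat ` {n. \<exists>P. (\<forall>i\<le>n. primeideal (P i) R) \<and> (\<forall>i<n. P i \<subset> P (Suc i))})"

definition char_ring :: "('a, 'b) ring_scheme \<Rightarrow> nat"
  where "char_ring R =
    (if \<exists>n::nat. n > 0 \<and> add_pow R n \<one>\<^bsub>R\<^esub> = \<zero>\<^bsub>R\<^esub>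
     then LEAST n::nat. n > 0 \<and> add_pow R n \<one>\<^bsub>R\<^esub> = \<zero>\<^bsub>R\<^esub> else 0)"

definition minimal_prime :: "'a set \<Rightarrow> ('a, 'b) ring_scheme \<Rightarrow> bool"
  where "minimal_prime P R \<longleftrightarrow> primeideal P R \<and> \<not> (\<exists>Q. primeideal Q R \<and> Q \<subset> P)"

text \<open>\<open>R\<^sup>0\<close> in the usual notation of tight closure theory.\<close>

definition off_minimal_primes :: "('a, 'b) ring_scheme \<Rightarrow> 'a set"
  where "off_minimal_primes R = carrier R - \<Union>{P. minimal_prime P R}"

definition bracket_power :: "('a, 'b) ring_scheme \<Rightarrow> 'a set \<Rightarrow> nat \<Rightarrow> 'a set"
  where "bracket_power R I q = Idl\<^bsub>R\<^esub> ((\<lambda>x. x [^]\<^bsub>R\<^esub> q) ` I)"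

text \<open>The parameter \<open>p\<close> is meant to be the characteristic of \<open>R\<close>.\<close>

definition tight_closure :: "('a, 'b) ring_scheme \<Rightarrow> nat \<Rightarrow> 'a set \<Rightarrow> 'a set"
  where "tight_closure R p I =
    {x \<in> carrier R. \<exists>c \<in> off_minimal_primes R. \<exists>e\<^sub>0. \<forall>e\<ge>e\<^sub>0.
       c \<otimes>\<^bsub>R\<^esub> x [^]\<^bsub>R\<^esub> (p ^ e) \<in> bracket_power R I (p ^ e)}"

text \<open>Powers of ideals are powers in the semiring of ideals of \<open>R\<close>; in particular
  the zeroth power of \<open>I\<close> is \<open>carrier R\<close>.\<close>

definition reduction :: "('a, 'b) ring_scheme \<Rightarrow> 'a set \<Rightarrow> 'a set \<Rightarrow> bool"
  where "reduction R I J \<longleftrightarrow> ideal J R \<and> J \<subseteq> I \<and>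
    (\<exists>n::nat. ideal_prod R J (I [^]\<^bsub>ideals_set R\<^esub> n) = I [^]\<^bsub>ideals_set R\<^esub> (n + 1))"

definition core :: "('a, 'b) ring_scheme \<Rightarrow> 'a set \<Rightarrow> 'a set"
  where "core R I = \<Inter>{J. reduction R I J}"

definition star_reduction :: "('a, 'b) ring_scheme \<Rightarrow> nat \<Rightarrow> 'a set \<Rightarrow> 'a set \<Rightarrow> bool"
  where "star_reduction R p I J \<longleftrightarrow> ideal J R \<and> J \<subseteq> I \<and> I \<subseteq> tight_closure R p J"

definition star_core :: "('a, 'b) ring_scheme \<Rightarrow> nat \<Rightarrow> 'a set \<Rightarrow> 'a set"
  where "star_core R p I = \<Inter>{J. star_reduction R p I J}"

end

theory Submission
  imports Defs
begin

text \<open>The reductions of \<open>I\<close> and its \<open>*\<close>-reductions are the same ideals. Say that \<open>x\<close> dominates an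
  ideal \<open>K\<close> if \<open>c K\<^sup>n \<subseteq> (x\<^sup>n)\<close> for a fixed \<open>c \<noteq> 0\<close> and all \<open>n\<close>; for \<open>x \<in> K\<close> this means that \<open>(x)\<close> is a
  reduction of \<open>K\<close>, because the ideals \<open>(c K\<^sup>n : x\<^sup>n)\<close> ascend and so become stationary. Every ideal \<open>J\<close>
  is dominated by one of its elements \<open>x\<close>. Hence, if \<open>J\<close> is a reduction of \<open>I\<close>, then
  \<open>c I\<^sup>n\<^sup>+\<^sup>q \<subseteq> c J\<^sup>q \<subseteq> (x\<^sup>q)\<close>, which gives \<open>I \<subseteq> J\<^sup>*\<close>; and if \<open>I \<subseteq> J\<^sup>*\<close>, then \<open>c d y\<^sup>q \<in> (x\<^sup>q)\<close> for every \<open>y \<in> I\<close>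
  and infinitely many \<open>q\<close>, so \<open>x\<close> dominates \<open>I\<close>.

  The existence of \<open>x\<close> reduces to \<open>J = (a, b)\<close>. Fix \<open>0 \<noteq> t \<in> \<mm>\<close>; every chain of ideals between \<open>t L\<close>
  and \<open>L \<noteq> 0\<close> has length at most \<open>e = \<ell>(R / t R)\<close>. Take \<open>n = e + 1\<close> and \<open>l\<^sub>i = a + u\<^sub>i b\<close> for
  \<open>i \<le> n\<close>, with \<open>u\<^sub>i\<close> distinct modulo \<open>\<mm>\<close>. Some product \<open>P\<^sub>j = \<Prod>\<^sub>i\<^sub>\<noteq>\<^sub>j l\<^sub>i\<close> lies in \<open>t J\<^sup>n\<close> plus the ideal of
  the earlier products, all divisible by \<open>l\<^sub>j\<close>; since \<open>P\<^sub>j\<close> is a unit multiple of \<open>b\<^sup>n\<close> modulo \<open>l\<^sub>j J\<^sup>n\<^sup>-\<^sup>1\<close>,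
  this yields \<open>J\<^sup>n \<subseteq> l\<^sub>j J\<^sup>n\<^sup>-\<^sup>1 + t J\<^sup>n\<close>, and \<open>t\<close> is nilpotent modulo \<open>l\<^sub>j\<close>.\<close>

section \<open>Ideals\<close>

lemma (in cring) ideal_prod_subset:
  assumes "ideal L R" and "\<And>i j. i \<in> I \<Longrightarrow> j \<in> J \<Longrightarrow> i \<otimes> j \<in> L"
  shows "I \<cdot> J \<subseteq> L"
proof
  fix s assume "s \<in> I \<cdot> J"
  then show "s \<in> L"
    by induct (use assms in \<open>auto simp: additive_subgroup.a_closed ideal.axioms(1)\<close>)
qed

lemma (in cring) ideal_prod_mono:
  assumes "ideal I' R" "ideal J' R" "I \<subseteq> I'" "J \<subseteq> J'"
  shows "I \<cdot> J \<subseteq> I' \<cdot> J'"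
  by (rule ideal_prod_subset) (use assms in \<open>auto intro: ideal_prod_is_ideal ideal_prod.prod\<close>)

context cring
begin

definition ideal_pow :: "'a set \<Rightarrow> nat \<Rightarrow> 'a set"
  where "ideal_pow I n = I [^]\<^bsub>ideals_set R\<^esub> n"

lemma ideal_pow_0 [simp]: "ideal_pow I 0 = carrier R"
  by (simp add: ideal_pow_def nat_pow_def ideals_set_def)

lemma ideal_pow_Suc: "ideal_pow I (Suc n) = ideal_pow I n \<cdot> I"
  by (simp add: ideal_pow_def nat_pow_def ideals_set_def)

lemma ideal_pow_ideal: "ideal I R \<Longrightarrow> ideal (ideal_pow I n) R"
  by (induct n) (auto simp: ideal_pow_Suc oneideal ideal_prod_is_ideal)

lemma ideal_pow_add:
  assumes "ideal I R"
  shows "ideal_pow I (m + n) = ideal_pow I m \<cdot> ideal_pow I n"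
proof -
  interpret S: comm_monoid "ideals_set R" by (rule ideals_set_is_comm_monoid)
  show ?thesis using S.nat_pow_mult[of I m n] assms by (simp add: ideal_pow_def ideals_set_def)
qed

lemma ideal_pow_1: "ideal I R \<Longrightarrow> ideal_pow I (Suc 0) = I"
  using ideal_prod_commute[of "carrier R" I] by (simp add: ideal_pow_Suc ideal_prod_one oneideal)

lemma mult_mem_ideal_pow_Suc: "v \<in> ideal_pow I n \<Longrightarrow> w \<in> I \<Longrightarrow> v \<otimes> w \<in> ideal_pow I (Suc n)"
  by (simp add: ideal_pow_Suc ideal_prod.prod)

lemma pow_mem_ideal_pow: "ideal I R \<Longrightarrow> y \<in> I \<Longrightarrow> y [^] n \<in> ideal_pow I n"
  by (induct n) (auto intro: mult_mem_ideal_pow_Suc)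

lemma ideal_pow_subset: "ideal I R \<Longrightarrow> ideal_pow I (Suc n) \<subseteq> ideal_pow I n"
  using ideal_prod_inter[OF ideal_pow_ideal] by (simp add: ideal_pow_Suc)

section \<open>Adjoining an element, ideal quotients and divisibility\<close>

definition adjoin :: "'a set \<Rightarrow> 'a \<Rightarrow> 'a set"
  where "adjoin K b = set_add R K (PIdl b)"

lemma mem_adjoin:
  "z \<in> adjoin K b \<longleftrightarrow> (\<exists>k\<in>K. \<exists>r\<in>carrier R. z = k \<oplus> r \<otimes> b)"
  by (auto simp: adjoin_def set_add_def' cgenideal_def)

lemma adjoin_ideal:
  "ideal K R \<Longrightarrow> b \<in> carrier R \<Longrightarrow> ideal (adjoin K b) R"
  unfolding adjoin_def by (intro add_ideals cgenideal_ideal)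

lemma adjoin_upper:
  assumes "ideal K R" "b \<in> carrier R"
  shows "K \<subseteq> adjoin K b" and "b \<in> adjoin K b"
proof -
  interpret K: ideal K R by fact
  show "K \<subseteq> adjoin K b"
  proof
    fix k assume "k \<in> K"
    then show "k \<in> adjoin K b"
      unfolding mem_adjoin using assms by (intro bexI[of _ k] bexI[of _ \<zero>]) auto
  qed
  show "b \<in> adjoin K b"
    unfolding mem_adjoin using assms by (intro bexI[of _ \<zero>] bexI[of _ \<one>]) (auto simp: K.zero_closed)
qed

lemma adjoin_least:
  assumes "ideal L R" "K \<subseteq> L" "b \<in> L"
  shows "adjoin K b \<subseteq> L"
proof -
  interpret L: ideal L R by fact
  show ?thesis using assms by (auto simp: mem_adjoin L.I_l_closed subset_iff)
qed

definition colon :: "'a set \<Rightarrow> 'a \<Rightarrow> 'a set"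
  where "colon K x = {r \<in> carrier R. x \<otimes> r \<in> K}"

lemma ideal_Collect:
  assumes "P \<zero>" "\<And>a b. a \<in> carrier R \<Longrightarrow> b \<in> carrier R \<Longrightarrow> P a \<Longrightarrow> P b \<Longrightarrow> P (a \<oplus> b)"
    and "\<And>a r. a \<in> carrier R \<Longrightarrow> r \<in> carrier R \<Longrightarrow> P a \<Longrightarrow> P (r \<otimes> a)"
  shows "ideal {a \<in> carrier R. P a} R"
proof (rule idealI[OF ring_axioms])
  show "subgroup {a \<in> carrier R. P a} (add_monoid R)"
  proof (rule add.subgroupI)
    fix a assume "a \<in> {a \<in> carrier R. P a}"
    then show "\<ominus> a \<in> {a \<in> carrier R. P a}"
      using assms(3)[of a "\<ominus> \<one>"] by (auto simp: l_minus)
  qed (use assms in auto)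
qed (use assms m_comm in auto)

lemma colon_ideal:
  assumes "ideal K R" "x \<in> carrier R"
  shows "ideal (colon K x) R"
proof -
  interpret K: ideal K R by fact
  show ?thesis unfolding colon_def
    by (rule ideal_Collect) (use assms in \<open>auto simp: r_distr m_lcomm K.I_l_closed\<close>)
qed

lemma subset_colon:
  assumes "ideal K R" "x \<in> carrier R"
  shows "K \<subseteq> colon K x"
  using assms by (auto simp: colon_def ideal.I_l_closed ideal.Icarr)

text \<open>Here \<open><#\<close> is the multiplicative coset, so \<open>x <# K\<close> is the
  product ideal x K.\<close>

lemma l_coset_ideal:
  assumes "ideal K R" "x \<in> carrier R"
  shows "ideal (x <# K) R"
proof -
  interpret K: ideal K R by fact
  have "x <# K = {a \<in> carrier R. \<exists>k\<in>K. a = x \<otimes> k}"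
    using assms by (auto simp: l_coset_def)
  moreover have "ideal {a \<in> carrier R. \<exists>k\<in>K. a = x \<otimes> k} R"
  proof (rule ideal_Collect)
    fix a b assume "\<exists>k\<in>K. a = x \<otimes> k" "\<exists>k\<in>K. b = x \<otimes> k"
    then obtain k l where "k \<in> K" "l \<in> K" "a = x \<otimes> k" "b = x \<otimes> l" by auto
    then show "\<exists>k\<in>K. a \<oplus> b = x \<otimes> k"
      using assms by (intro bexI[of _ "k \<oplus> l"]) (auto simp: r_distr)
  next
    fix a r assume "r \<in> carrier R" "\<exists>k\<in>K. a = x \<otimes> k"
    then obtain k where "k \<in> K" "a = x \<otimes> k" by auto
    then show "\<exists>k\<in>K. r \<otimes> a = x \<otimes> k"
      using assms \<open>r \<in> carrier R\<close>
      by (intro bexI[of _ "r \<otimes> k"]) (auto simp: m_lcomm K.I_l_closed)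
  qed (use assms in \<open>auto intro!: bexI[of _ \<zero>]\<close>)
  ultimately show ?thesis by simp
qed

lemma divides_add:
  assumes "x \<in> carrier R" "x divides a" "x divides b"
  shows "x divides (a \<oplus> b)"
proof -
  obtain c d where "c \<in> carrier R" "d \<in> carrier R" "a = x \<otimes> c" "b = x \<otimes> d"
    using assms by (auto simp: factor_def)
  then show ?thesis
    using assms(1) by (intro dividesI[of "c \<oplus> d"]) (auto simp: r_distr)
qed

lemma divides_mult_right:
  assumes "x \<in> carrier R" "r \<in> carrier R" "x divides a"
  shows "x divides (a \<otimes> r)"
proof -
  obtain c where "c \<in> carrier R" "a = x \<otimes> c"
    using assms by (auto simp: factor_def)
  then show ?thesis
    using assms by (intro dividesI[of "c \<otimes> r"]) (auto simp: m_assoc)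
qed

lemma divides_mult_mult:
  assumes "x \<in> carrier R" "y \<in> carrier R" "x divides a" "y divides b"
  shows "x \<otimes> y divides a \<otimes> b"
proof -
  obtain c d where "c \<in> carrier R" "d \<in> carrier R" "a = x \<otimes> c" "b = y \<otimes> d"
    using assms by (auto simp: factor_def)
  then show ?thesis
    using assms by (intro dividesI[of "c \<otimes> d"]) (auto simp: m_ac)
qed

section \<open>Domination\<close>

text \<open>In a domain, \<open>dominates_elem x y\<close> says that \<open>y\<close> lies in the complete integral closure of
  \<open>(x)\<close>.\<close>

definition dominates :: "'a \<Rightarrow> 'a set \<Rightarrow> bool"
  where "dominates x K \<longleftrightarrow>
    (\<exists>c\<in>carrier R - {\<zero>}. \<forall>n. \<forall>w\<in>ideal_pow K n. x [^] n divides c \<otimes> w)"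

definition dominates_elem :: "'a \<Rightarrow> 'a \<Rightarrow> bool"
  where "dominates_elem x y \<longleftrightarrow>
    (\<exists>c\<in>carrier R - {\<zero>}. \<forall>n::nat. x [^] n divides c \<otimes> y [^] n)"

end

context domain
begin

text \<open>Denominators multiply: z^n divides d x^n and x^n divides c w, so z^n divides d c
  w.\<close>

lemma dominates_trans:
  assumes "dominates x K" "dominates_elem z x" "ideal K R" "x \<in> carrier R" "z \<in> carrier R"
  shows "dominates z K"
proof -
  obtain c where c: "c \<in> carrier R - {\<zero>}" "\<And>n w. w \<in> ideal_pow K n \<Longrightarrow> x [^] n divides c \<otimes> w"
    using assms(1) by (auto simp: dominates_def)
  obtain d where d: "d \<in> carrier R - {\<zero>}" "\<And>n::nat. z [^] n divides d \<otimes> x [^] n"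
    using assms(2) by (auto simp: dominates_elem_def)
  have "z [^] n divides (d \<otimes> c) \<otimes> w" if w: "w \<in> ideal_pow K n" for n w
  proof -
    have wc: "w \<in> carrier R" using w ideal_pow_ideal[OF assms(3)] ideal.Icarr by metis
    have "d \<otimes> x [^] n divides d \<otimes> (c \<otimes> w)"
      using c(2)[OF w] assms d by (intro divides_mult) auto
    with d(2)[of n] show ?thesis
      using assms c d wc by (metis DiffD1 divides_trans m_assoc nat_pow_closed)
  qed
  then show ?thesis
    unfolding dominates_def using c d by (intro bexI[of _ "d \<otimes> c"]) (auto simp: integral_iff)
qed

lemma dominates_zero:
  assumes "x \<in> carrier R"
  shows "dominates x {\<zero>}"
proof -
  have "x [^] n divides \<one> \<otimes> w" if "w \<in> ideal_pow {\<zero>} n" for n w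
  proof (cases n)
    case 0
    then show ?thesis using that by (auto simp: one_divides)
  next
    case (Suc k)
    then have "w = \<zero>"
      using that ideal_prod_zero[OF ideal_pow_ideal[OF zeroideal]] by (simp add: ideal_pow_Suc)
    then show ?thesis using assms by (auto simp: divides_zero)
  qed
  then show ?thesis unfolding dominates_def by (intro bexI[of _ \<one>]) auto
qed

text \<open>The powers of K + (b) are spanned by products w b^k with w in K^i; one constant takes
  care of w, the other of b^k, so \<open>c \<otimes> d\<close> works for every product.\<close>

lemma dominates_adjoin:
  assumes "dominates x K" "dominates_elem x b" "ideal K R" "x \<in> carrier R" "b \<in> carrier R"
  shows "dominates x (adjoin K b)"
proof -
  interpret K: ideal K R by fact
  obtain c where c: "c \<in> carrier R - {\<zero>}" "\<And>n w. w \<in> ideal_pow K n \<Longrightarrow> x [^] n divides c \<otimes> w"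
    using assms(1) by (auto simp: dominates_def)
  obtain d where d: "d \<in> carrier R - {\<zero>}" "\<And>n::nat. x [^] n divides d \<otimes> b [^] n"
    using assms(2) by (auto simp: dominates_elem_def)
  note [simp] = assms(4,5)
  have [simp]: "c \<in> carrier R" "d \<in> carrier R" using c d by auto
  have pc: "w \<in> carrier R" if "w \<in> ideal_pow K i" for w i
    using that ideal_pow_ideal[OF assms(3)] ideal.Icarr by metis
  \<comment> \<open>The factors \<open>w\<close> and \<open>b\<^sup>k\<close> make \<open>(K + (b))\<^sup>n \<subseteq> V n\<close> provable by induction on \<open>n\<close>: each new
    factor \<open>l + r b\<close> is absorbed into one of them.\<close>
  define V where "V n = {z \<in> carrier R. \<forall>i k. \<forall>w\<in>ideal_pow K i.
    x [^] (n + i + k) divides ((c \<otimes> d) \<otimes> (z \<otimes> (w \<otimes> b [^] k)))}" for n :: nat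
  have VI: "z \<in> V n" if "z \<in> carrier R" "\<And>i k w. w \<in> ideal_pow K i \<Longrightarrow>
    x [^] (n + i + k) divides ((c \<otimes> d) \<otimes> (z \<otimes> (w \<otimes> b [^] k)))" for n z
    using that unfolding V_def by blast
  have V: "ideal (V n) R" for n
    unfolding V_def
  proof (rule ideal_Collect, safe)
    fix i k :: nat and w assume w: "w \<in> ideal_pow K i"
    show "x [^] (n + i + k) divides ((c \<otimes> d) \<otimes> (\<zero> \<otimes> (w \<otimes> b [^] k)))"
      using pc[OF w] by (auto simp: divides_zero)
  next
    fix y z and i k :: nat and w assume w: "w \<in> ideal_pow K i" and yz: "y \<in> carrier R" "z \<in> carrier R"
      "\<forall>i k. \<forall>w\<in>ideal_pow K i. x [^] (n + i + k) divides ((c \<otimes> d) \<otimes> (y \<otimes> (w \<otimes> b [^] k)))"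
      "\<forall>i k. \<forall>w\<in>ideal_pow K i. x [^] (n + i + k) divides ((c \<otimes> d) \<otimes> (z \<otimes> (w \<otimes> b [^] k)))"
    then have "x [^] (n + i + k) divides ((c \<otimes> d) \<otimes> (y \<otimes> (w \<otimes> b [^] k)) \<oplus> (c \<otimes> d) \<otimes> (z \<otimes> (w \<otimes> b [^] k)))"
      by (intro divides_add) auto
    then show "x [^] (n + i + k) divides ((c \<otimes> d) \<otimes> ((y \<oplus> z) \<otimes> (w \<otimes> b [^] k)))"
      using yz pc[OF w] by (auto simp: l_distr r_distr)
  next
    fix y r and i k :: nat and w assume w: "w \<in> ideal_pow K i" and yr: "y \<in> carrier R" "r \<in> carrier R"
      "\<forall>i k. \<forall>w\<in>ideal_pow K i. x [^] (n + i + k) divides ((c \<otimes> d) \<otimes> (y \<otimes> (w \<otimes> b [^] k)))"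
    then have "x [^] (n + i + k) divides ((c \<otimes> d) \<otimes> (y \<otimes> (w \<otimes> b [^] k)) \<otimes> r)"
      using w pc[OF w] by (rule_tac divides_mult_right) auto
    then show "x [^] (n + i + k) divides ((c \<otimes> d) \<otimes> ((r \<otimes> y) \<otimes> (w \<otimes> b [^] k)))"
      using yr pc[OF w] by (auto simp: m_ac)
  qed
  have sub: "ideal_pow (adjoin K b) n \<subseteq> V n" for n
  proof (induct n)
    case 0
    have "x [^] (i + k) divides ((c \<otimes> d) \<otimes> (z \<otimes> (w \<otimes> b [^] k)))"
      if "z \<in> carrier R" "w \<in> ideal_pow K i" for i k z w
    proof -
      have "x [^] i \<otimes> x [^] k divides ((c \<otimes> w) \<otimes> (d \<otimes> b [^] k))"
        using c(2)[OF that(2)] d(2)[of k] by (intro divides_mult_mult) auto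
      then have "x [^] i \<otimes> x [^] k divides (((c \<otimes> w) \<otimes> (d \<otimes> b [^] k)) \<otimes> z)"
        using that pc[OF that(2)] by (rule_tac divides_mult_right) auto
      then show ?thesis using that pc[OF that(2)] by (simp add: nat_pow_mult m_ac)
    qed
    then show ?case by (auto simp: V_def)
  next
    case (Suc n)
    show ?case unfolding ideal_pow_Suc
    proof (rule ideal_prod_subset[OF V])
      fix z y assume z: "z \<in> ideal_pow (adjoin K b) n" and "y \<in> adjoin K b"
      then obtain l r where lr: "l \<in> K" "r \<in> carrier R" "y = l \<oplus> r \<otimes> b"
        by (auto simp: mem_adjoin)
      have zV: "z \<in> V n" using z Suc by auto
      then have [simp]: "z \<in> carrier R" by (simp add: V_def)
      have l: "l \<in> carrier R" using lr by auto
      interpret Vn: ideal "V (Suc n)" R by (rule V)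
      have "z \<otimes> l \<in> V (Suc n)"
      proof -
        have "x [^] (Suc n + i + k) divides ((c \<otimes> d) \<otimes> ((z \<otimes> l) \<otimes> (w \<otimes> b [^] k)))"
          if w: "w \<in> ideal_pow K i" for i k w
        proof -
          have "x [^] (n + Suc i + k) divides ((c \<otimes> d) \<otimes> (z \<otimes> ((w \<otimes> l) \<otimes> b [^] k)))"
            using zV mult_mem_ideal_pow_Suc[OF w lr(1)] unfolding V_def by blast
          moreover have "(z \<otimes> l) \<otimes> (w \<otimes> b [^] k) = z \<otimes> ((w \<otimes> l) \<otimes> b [^] k)"
            using pc[OF w] l by (simp add: m_ac)
          ultimately show ?thesis by (simp del: nat_pow_Suc)
        qed
        then show ?thesis using l by (intro VI) auto
      qed
      moreover have "z \<otimes> b \<in> V (Suc n)"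
      proof -
        have "x [^] (Suc n + i + k) divides ((c \<otimes> d) \<otimes> ((z \<otimes> b) \<otimes> (w \<otimes> b [^] k)))"
          if w: "w \<in> ideal_pow K i" for i k w
        proof -
          have "x [^] (n + i + Suc k) divides ((c \<otimes> d) \<otimes> (z \<otimes> (w \<otimes> b [^] Suc k)))"
            using zV w unfolding V_def by blast
          moreover have "(z \<otimes> b) \<otimes> (w \<otimes> b [^] k) = z \<otimes> (w \<otimes> b [^] Suc k)"
            using pc[OF w] by (simp add: m_ac)
          ultimately show ?thesis by (simp del: nat_pow_Suc)
        qed
        then show ?thesis by (intro VI) auto
      qed
      ultimately have "z \<otimes> l \<oplus> r \<otimes> (z \<otimes> b) \<in> V (Suc n)"
        using lr by (simp add: Vn.I_l_closed)
      moreover have "z \<otimes> y = z \<otimes> l \<oplus> r \<otimes> (z \<otimes> b)"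
        using lr l by (simp add: r_distr m_ac)
      ultimately show "z \<otimes> y \<in> V (Suc n)" by simp
    qed
  qed
  have "x [^] n divides ((c \<otimes> d) \<otimes> z)" if "z \<in> ideal_pow (adjoin K b) n" for n z
  proof -
    have "z \<in> V n" using sub that by auto
    then have z: "z \<in> carrier R" "\<And>i k w. w \<in> ideal_pow K i \<Longrightarrow>
        x [^] (n + i + k) divides ((c \<otimes> d) \<otimes> (z \<otimes> (w \<otimes> b [^] k)))"
      by (simp_all add: V_def)
    \<comment> \<open>The case i = k = 0 with w = 1 strips the auxiliary factors off again.\<close>
    have "\<one> \<in> ideal_pow K 0" by simp
    from z(2)[OF this, of 0] z(1)show ?thesis by simp
  qed
  then show ?thesis
    unfolding dominates_def using c d by (intro bexI[of _ "c \<otimes> d"]) (auto simp: integral_iff)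
qed

end

section \<open>Stationary chains and integral equations\<close>

context noetherian_ring
begin

text \<open>The union of a nonempty chain of ideals already belongs to the chain, so Zorn's lemma
  applies inside any nonempty family.\<close>

lemma exists_maximal_ideal_in:
  assumes "S \<noteq> {}" "\<And>K. K \<in> S \<Longrightarrow> ideal K R"
  shows "\<exists>M\<in>S. \<forall>K\<in>S. M \<subseteq> K \<longrightarrow> K = M"
proof (rule subset_Zorn_nonempty[OF assms(1)])
  fix C assume C: "C \<noteq> {}" "subset.chain S C"
  then have "subset.chain {I. ideal I R} C"
    using assms(2) by (auto simp: subset_chain_def)
  then have "\<Union>C \<in> C" using C(1) ideal_chain_is_trivial by blast
  then show "\<Union>C \<in> S" using C(2) by (auto simp: subset_chain_def)
qed

lemma noetherian_induct [consumes 1, case_names less]: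
  assumes "ideal K R"
    and "\<And>K. ideal K R \<Longrightarrow> (\<And>L. ideal L R \<Longrightarrow> K \<subset> L \<Longrightarrow> P L) \<Longrightarrow> P K"
  shows "P K"
proof (rule ccontr)
  assume "\<not> P K"
  then have "\<exists>M\<in>{L. ideal L R \<and> \<not> P L}. \<forall>L\<in>{L. ideal L R \<and> \<not> P L}. M \<subseteq> L \<longrightarrow> L = M"
    using assms(1) by (intro exists_maximal_ideal_in) auto
  then obtain M where M: "ideal M R" "\<not> P M" "\<And>L. ideal L R \<Longrightarrow> \<not> P L \<Longrightarrow> M \<subseteq> L \<Longrightarrow> L = M"
    by auto
  then show False using assms(2)[of M] by blast
qed

lemma ascending_chain_stationary:
  fixes A :: "nat \<Rightarrow> 'a set"
  assumes "\<And>n. ideal (A n) R" "\<And>n. A n \<subseteq> A (Suc n)"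
  shows "\<exists>N. \<forall>n\<ge>N. A n = A N"
proof -
  have "\<exists>M\<in>range A. \<forall>K\<in>range A. M \<subseteq> K \<longrightarrow> K = M"
    using assms(1) by (intro exists_maximal_ideal_in) auto
  then obtain N where "\<forall>K\<in>range A. A N \<subseteq> K \<longrightarrow> K = A N" by auto
  then have N: "A n = A N" if "A N \<subseteq> A n" for n using that by simp
  have "A N \<subseteq> A n" if "n \<ge> N" for n
    using that assms(2) by (rule lift_Suc_mono_le[rotated])
  then show ?thesis using N by metis
qed

end

text \<open>Finite generation as an induction rule: an ideal maximal among those inside
  \<open>J\<close> with \<open>P\<close> must be \<open>J\<close>, as any \<open>b\<close> in
  \<open>J\<close> can be adjoined to it.\<close>

lemma (in noetherian_domain) adjoin_induct [consumes 1, case_names zero adjoin]: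
  assumes "ideal J R" and "P {\<zero>}"
    and "\<And>K b. ideal K R \<Longrightarrow> K \<subseteq> J \<Longrightarrow> P K \<Longrightarrow> b \<in> J \<Longrightarrow> P (adjoin K b)"
  shows "P J"
proof -
  interpret J: ideal J R by fact
  let ?S = "{K. ideal K R \<and> K \<subseteq> J \<and> P K}"
  have "\<exists>M\<in>?S. \<forall>K\<in>?S. M \<subseteq> K \<longrightarrow> K = M"
    using assms(2) zeroideal by (intro exists_maximal_ideal_in) (auto intro!: exI[of _ "{\<zero>}"])
  then obtain M where M: "ideal M R" "M \<subseteq> J" "P M" "\<And>K. K \<in> ?S \<Longrightarrow> M \<subseteq> K \<Longrightarrow> K = M"
    by auto
  have "J \<subseteq> M"
  proof
    fix b assume b: "b \<in> J"
    then have bc: "b \<in> carrier R" by auto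
    have "adjoin M b \<in> ?S"
      using M b bc assms(1) adjoin_ideal adjoin_least assms(3) by auto
    then have "adjoin M b = M" using M(4) adjoin_upper[OF M(1) bc] by auto
    then show "b \<in> M" using adjoin_upper[OF M(1) bc] by auto
  qed
  with M show ?thesis by auto
qed

section \<open>Integral equations over a principal ideal\<close>

context domain
begin

lemma pow_nonzero: "x \<in> carrier R \<Longrightarrow> x \<noteq> \<zero> \<Longrightarrow> x [^] (n::nat) \<noteq> \<zero>"
  by (induct n) (auto simp: integral_iff)

text \<open>Iterating the inclusion gives K^(n+k) inside x^k K^n. Since x^n y^k lies in K^(n+k), the
  nonzero constant x^n serves for all k.\<close>

lemma dominates_elem_if_principal_reduction:
  assumes "ideal_pow K (Suc n) \<subseteq> x <# ideal_pow K n" "ideal K R"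
    and "x \<in> K" "x \<noteq> \<zero>" "y \<in> K"
  shows "dominates_elem x y"
proof -
  have [simp]: "x \<in> carrier R" using assms ideal.Icarr by metis
  note pc = ideal.Icarr[OF ideal_pow_ideal[OF assms(2)]]
  have sub: "ideal_pow K (n + k) \<subseteq> (x [^] k) <# ideal_pow K n" for k
  proof (induct k)
    case 0
    show ?case by (auto simp: l_coset_def pc)
  next
    case (Suc k)
    have "ideal_pow K (Suc (n + k)) \<subseteq> (x [^] Suc k) <# ideal_pow K n"
      unfolding ideal_pow_Suc
    proof (rule ideal_prod_subset)
      show "ideal ((x [^] Suc k) <# ideal_pow K n) R"
        using assms by (intro l_coset_ideal ideal_pow_ideal) auto
      fix i j assume "i \<in> ideal_pow K (n + k)" and j: "j \<in> K"
      then obtain w where w: "w \<in> ideal_pow K n" "i = x [^] k \<otimes> w"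
        using Suc by (auto simp: l_coset_def)
      have "w \<otimes> j \<in> ideal_pow K (Suc n)"
        using w j by (simp add: mult_mem_ideal_pow_Suc)
      then obtain v where v: "v \<in> ideal_pow K n" "w \<otimes> j = x \<otimes> v"
        using assms(1) by (auto simp: l_coset_def)
      have "i \<otimes> j = x [^] k \<otimes> (w \<otimes> j)"
        using w j assms pc ideal.Icarr[OF assms(2)] by (simp add: m_assoc)
      also have "\<dots> = x [^] Suc k \<otimes> v"
        using v assms pc by (simp add: m_assoc)
      finally show "i \<otimes> j \<in> (x [^] Suc k) <# ideal_pow K n"
        using v by (auto simp: l_coset_def)
    qed
    then show ?case by simp
  qed
  have "x [^] k divides x [^] n \<otimes> y [^] k" for k :: nat
  proof -
    have "x [^] n \<otimes> y [^] k \<in> ideal_pow K (n + k)"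
      using assms by (auto simp: ideal_pow_add intro: ideal_prod.prod pow_mem_ideal_pow)
    then obtain v where "v \<in> ideal_pow K n" "x [^] n \<otimes> y [^] k = x [^] k \<otimes> v"
      using sub[of k] by (auto simp: l_coset_def)
    then show ?thesis
      using pc by (intro dividesI[of v]) auto
  qed
  then show ?thesis
    unfolding dominates_elem_def using assms pow_nonzero by (intro bexI[of _ "x [^] n"]) auto
qed


lemma adjoin_cgenideal:
  assumes "x \<in> carrier R" "y \<in> carrier R"
  shows "ideal (adjoin (PIdl x) y) R" "x \<in> adjoin (PIdl x) y" "y \<in> adjoin (PIdl x) y"
proof -
  have x: "ideal (PIdl x) R" "x \<in> PIdl x"
    using assms by (simp_all add: cgenideal_ideal cgenideal_self)
  show "ideal (adjoin (PIdl x) y) R" "y \<in> adjoin (PIdl x) y"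
    using assms x by (simp_all add: adjoin_ideal adjoin_upper)
  show "x \<in> adjoin (PIdl x) y"
    using adjoin_upper(1)[OF x(1) assms(2)] x(2) by blast
qed

text \<open>Of the monomials of degree n + 1 in x and y, only y^(n+1) lacks a factor x.\<close>

lemma ideal_pow_adjoin_cgenideal:
  assumes "x \<in> carrier R" "y \<in> carrier R"
  defines "Q \<equiv> adjoin (PIdl x) y"
  shows "ideal_pow Q (Suc n) \<subseteq> adjoin (x <# ideal_pow Q n) (y [^] Suc n)"
proof (induct n)
  have Q: "ideal Q R" "PIdl x \<subseteq> Q" "y \<in> Q"
    unfolding Q_def using adjoin_ideal adjoin_upper assms(1,2) cgenideal_ideal by auto
  {
    case 0
    have "PIdl x \<subseteq> x <# carrier R"
      using assms m_comm by (auto simp: cgenideal_def l_coset_def)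
    then have "Q \<subseteq> adjoin (x <# carrier R) y"
      unfolding Q_def using assms
      by (intro adjoin_least adjoin_ideal order_trans[OF _ adjoin_upper(1)] adjoin_upper(2)
          l_coset_ideal oneideal)
    then show ?case using Q assms by (simp add: ideal_pow_1)
  next
    case (Suc n)
    note pc = ideal.Icarr[OF ideal_pow_ideal[OF Q(1)]]
    let ?L = "x <# ideal_pow Q (Suc n)"
    let ?A = "adjoin ?L (y [^] Suc (Suc n))"
    have L: "ideal ?L R" using assms Q by (intro l_coset_ideal ideal_pow_ideal)
    have A: "ideal ?A R" using assms by (intro adjoin_ideal L) auto
    have up: "?L \<subseteq> ?A" "y [^] Suc (Suc n) \<in> ?A"
      using assms by (intro adjoin_upper L; simp)+
    show ?case unfolding ideal_pow_Suc[of Q "Suc n"]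
    proof (rule ideal_prod_subset[OF A])
      fix i j assume i: "i \<in> ideal_pow Q (Suc n)" and j: "j \<in> Q"
      from i Suc have "i \<in> adjoin (x <# ideal_pow Q n) (y [^] Suc n)" by blast
      then obtain w r where w: "w \<in> ideal_pow Q n" "r \<in> carrier R"
        "i = x \<otimes> w \<oplus> r \<otimes> y [^] Suc n"
        by (auto simp: mem_adjoin l_coset_def simp del: nat_pow_Suc)
      obtain s t where st: "s \<in> carrier R" "t \<in> carrier R" "j = s \<otimes> x \<oplus> t \<otimes> y"
        using j unfolding Q_def by (auto simp: mem_adjoin cgenideal_def)
      interpret A: ideal ?A R by (rule A)
      interpret P: ideal "ideal_pow Q (Suc n)" R by (rule ideal_pow_ideal[OF Q(1)])
      have "y [^] Suc n \<in> ideal_pow Q (Suc n)"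
        using Q by (intro pow_mem_ideal_pow)
      then have "w \<otimes> j \<oplus> (r \<otimes> s) \<otimes> y [^] Suc n \<in> ideal_pow Q (Suc n)"
        using w(1,2) j st(1,2) P.I_l_closed mult_mem_ideal_pow_Suc
        by (intro P.a_closed) (auto simp del: nat_pow_Suc)
      then have "x \<otimes> (w \<otimes> j \<oplus> (r \<otimes> s) \<otimes> y [^] Suc n) \<in> ?A"
        using up by (auto simp: l_coset_def)
      moreover have "(r \<otimes> t) \<otimes> y [^] Suc (Suc n) \<in> ?A"
        using up(2) w(2) st(2) by (intro A.I_l_closed m_closed)
      ultimately have "x \<otimes> (w \<otimes> j \<oplus> (r \<otimes> s) \<otimes> y [^] Suc n) \<oplus> (r \<otimes> t) \<otimes> y [^] Suc (Suc n) \<in> ?A"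
        by (rule A.a_closed)
      moreover have "i \<otimes> j = x \<otimes> (w \<otimes> j \<oplus> (r \<otimes> s) \<otimes> y [^] Suc n) \<oplus> (r \<otimes> t) \<otimes> y [^] Suc (Suc n)"
      proof -
        define u where "u = y [^] Suc n"
        have [simp]: "w \<in> carrier R" "u \<in> carrier R"
          using w pc assms by (auto simp: u_def)
        have "(x \<otimes> w \<oplus> r \<otimes> u) \<otimes> (s \<otimes> x \<oplus> t \<otimes> y) =
          x \<otimes> (w \<otimes> (s \<otimes> x \<oplus> t \<otimes> y) \<oplus> (r \<otimes> s) \<otimes> u) \<oplus> (r \<otimes> t) \<otimes> (u \<otimes> y)"
          using w(2) st(1,2) assms(1,2) \<open>w \<in> carrier R\<close> \<open>u \<in> carrier R\<close> by algebra
        then show ?thesis unfolding w st u_def by simp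
      qed
      ultimately show "i \<otimes> j \<in> ?A" by simp
    qed
  }
qed

text \<open>The hypothesis on y^(n+1) is an integral equation of y over (x): it puts the one
  remaining monomial into x (x, y)^n, so (x) is a reduction of (x, y).\<close>

lemma dominates_elem_if_monic:
  assumes "x \<in> carrier R" "y \<in> carrier R" "x \<noteq> \<zero>"
    and "y [^] Suc n \<in> x <# ideal_pow (adjoin (PIdl x) y) n"
  shows "dominates_elem x y"
proof (rule dominates_elem_if_principal_reduction)
  let ?Q = "adjoin (PIdl x) y"
  show Q: "ideal ?Q R" "y \<in> ?Q" "x \<in> ?Q"
    using assms(1,2) by (simp_all add: adjoin_cgenideal)
  have "adjoin (x <# ideal_pow ?Q n) (y [^] Suc n) \<subseteq> x <# ideal_pow ?Q n"
    using assms Q by (intro adjoin_least l_coset_ideal ideal_pow_ideal) auto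
  then show "ideal_pow ?Q (Suc n) \<subseteq> x <# ideal_pow ?Q n"
    using ideal_pow_adjoin_cgenideal[OF assms(1,2)] by blast
qed fact

end

context noetherian_domain
begin

text \<open>The ideals \<open>(d K\<^sup>n : x\<^sup>n)\<close> ascend because \<open>x \<in> K\<close>; once they are stationary, a common
  denominator \<open>d\<close> for the fractions \<open>w / x\<^sup>n\<close> turns into an integral equation.\<close>

lemma ideal_pow_stationary:
  assumes "ideal K R" "x \<in> K" "x \<noteq> \<zero>" "d \<in> carrier R" "d \<noteq> \<zero>"
  shows "\<exists>N. \<forall>n\<ge>N. \<forall>w\<in>ideal_pow K n. x [^] n divides d \<otimes> w \<longrightarrow>
    (\<exists>v\<in>ideal_pow K N. w = x [^] (n - N) \<otimes> v)"
proof -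
  have [simp]: "x \<in> carrier R" "d \<in> carrier R" using assms ideal.Icarr by metis+
  note pc = ideal.Icarr[OF ideal_pow_ideal[OF assms(1)]]
  define A where "A n = colon (d <# ideal_pow K n) (x [^] n)" for n :: nat
  have "ideal (A n) R" for n
    unfolding A_def using assms by (intro colon_ideal l_coset_ideal ideal_pow_ideal) auto
  moreover have "A n \<subseteq> A (Suc n)" for n
  proof
    fix s assume "s \<in> A n"
    then obtain v where v: "s \<in> carrier R" "v \<in> ideal_pow K n" "x [^] n \<otimes> s = d \<otimes> v"
      by (auto simp: A_def colon_def l_coset_def)
    have "x [^] Suc n \<otimes> s = (x [^] n \<otimes> s) \<otimes> x"
      using v(1) by (simp add: m_ac)
    also have "\<dots> = d \<otimes> (v \<otimes> x)"
      using v pc by (simp add: m_ac)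
    finally show "s \<in> A (Suc n)"
      using v mult_mem_ideal_pow_Suc[OF v(2) assms(2)]
      by (auto simp: A_def colon_def l_coset_def simp del: nat_pow_Suc)
  qed
  ultimately obtain N where N: "\<And>n. n \<ge> N \<Longrightarrow> A n = A N"
    using ascending_chain_stationary[of A] by blast
  have "\<exists>v\<in>ideal_pow K N. w = x [^] (n - N) \<otimes> v"
    if n: "n \<ge> N" and w: "w \<in> ideal_pow K n" "x [^] n divides d \<otimes> w" for n w
  proof -
    obtain s where s: "s \<in> carrier R" "d \<otimes> w = x [^] n \<otimes> s"
      using w(2) by (auto simp: factor_def)
    then have "x [^] n \<otimes> s \<in> d <# ideal_pow K n"
      using w(1) s(2)[symmetric] by (auto simp: l_coset_def)
    then have "s \<in> A N" using s(1) N[OF n] by (auto simp: A_def colon_def)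
    then obtain v where v: "v \<in> ideal_pow K N" "x [^] N \<otimes> s = d \<otimes> v"
      by (auto simp: A_def colon_def l_coset_def)
    have [simp]: "v \<in> carrier R" "w \<in> carrier R" using v w pc by auto
    have "d \<otimes> w = (x [^] (n - N) \<otimes> x [^] N) \<otimes> s"
      using n s(2) by (simp add: nat_pow_mult)
    also have "\<dots> = d \<otimes> (x [^] (n - N) \<otimes> v)"
      using s(1) v(2) by (simp add: m_assoc m_lcomm)
    finally have "w = x [^] (n - N) \<otimes> v"
      using assms(5) by (subst (asm) m_lcancel) auto
    with v(1) show ?thesis by blast
  qed
  then show ?thesis by blast
qed

text \<open>For x nonzero, stationarity is applied one degree above the index N: each element of
  K^(N+1) is x times an element of K^N.\<close>

lemma dominates_imp_principal_reduction:
  assumes "dominates x K" "ideal K R" "x \<in> K"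
  shows "\<exists>n. ideal_pow K (Suc n) \<subseteq> x <# ideal_pow K n"
proof -
  have [simp]: "x \<in> carrier R" using assms ideal.Icarr by metis
  note pc = ideal.Icarr[OF ideal_pow_ideal[OF assms(2)]]
  obtain c where c: "c \<in> carrier R" "c \<noteq> \<zero>"
    "\<And>n w. w \<in> ideal_pow K n \<Longrightarrow> x [^] n divides c \<otimes> w"
    using assms(1) by (auto simp: dominates_def)
  show ?thesis
  proof (cases "x = \<zero>")
    \<comment> \<open>For x = 0, domination in degree 1 forces K = 0.\<close>
    case True
    have "w = \<zero>" if w: "w \<in> ideal_pow K (Suc 0)" for w
    proof -
      have "c \<otimes> w = \<zero>" using c(3)[OF w] pc[OF w] True by (auto simp: factor_def)
      then show ?thesis using c pc[OF w] by (auto simp: integral_iff)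
    qed
    then have "ideal_pow K (Suc 0) \<subseteq> x <# ideal_pow K 0"
      using True by (auto simp: l_coset_def intro!: bexI[of _ \<zero>])
    then show ?thesis by blast
  next
    case False
    obtain N where N: "\<And>n w. n \<ge> N \<Longrightarrow> w \<in> ideal_pow K n \<Longrightarrow> x [^] n divides c \<otimes> w \<Longrightarrow>
        \<exists>v\<in>ideal_pow K N. w = x [^] (n - N) \<otimes> v"
      using ideal_pow_stationary[OF assms(2,3) False c(1,2)] by blast
    have "w \<in> x <# ideal_pow K N" if w: "w \<in> ideal_pow K (Suc N)" for w
      using N[OF _ w c(3)[OF w]] by (auto simp: l_coset_def)
    then show ?thesis by blast
  qed
qed

text \<open>For x nonzero, a single exponent q beyond the stationary index yields an integral
  equation of y over (x), and this gives divisibility for all exponents with a new constant. Tight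
  closure provides only exponents that are powers of p.\<close>

lemma dominates_elem_if_frequently:
  assumes "x \<in> carrier R" "y \<in> carrier R" "d \<in> carrier R" "d \<noteq> \<zero>"
    and "\<And>N. \<exists>q>N. x [^] (q::nat) divides d \<otimes> y [^] q"
  shows "dominates_elem x y"
proof (cases "x = \<zero>")
  case True
  obtain q :: nat where q: "q > 0" "x [^] q divides d \<otimes> y [^] q" using assms(5) by blast
  then have "d \<otimes> y [^] q = \<zero>"
    using True by (auto simp: factor_def nat_pow_zero)
  then have "y = \<zero>"
    using assms pow_nonzero by (auto simp: integral_iff)
  then show ?thesis
    unfolding dominates_elem_def using True by (intro bexI[of _ \<one>]) auto
next
  case False
  let ?Q = "adjoin (PIdl x) y"
  have Q: "ideal ?Q R" "y \<in> ?Q" "x \<in> ?Q"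
    using assms(1,2) by (simp_all add: adjoin_cgenideal)
  note pc = ideal.Icarr[OF ideal_pow_ideal[OF Q(1)]]
  obtain N where N: "\<And>n w. n \<ge> N \<Longrightarrow> w \<in> ideal_pow ?Q n \<Longrightarrow> x [^] n divides d \<otimes> w \<Longrightarrow>
      \<exists>v\<in>ideal_pow ?Q N. w = x [^] (n - N) \<otimes> v"
    using ideal_pow_stationary[OF Q(1,3) False assms(3,4)] by blast
  obtain q where q: "q > N" "x [^] (q::nat) divides d \<otimes> y [^] q" using assms(5) by blast
  obtain v where v: "v \<in> ideal_pow ?Q N" "y [^] q = x [^] (q - N) \<otimes> v"
    using N[OF _ pow_mem_ideal_pow[OF Q(1,2)] q(2)] q(1) by auto
  \<comment> \<open>Writing q - N = k + 1 leaves one factor x in front of x^k v, which lies in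
    Q^(q-1).\<close>
  obtain k where k: "q = Suc (N + k)" using q(1) less_imp_Suc_add by blast
  have "x [^] k \<otimes> v \<in> ideal_pow ?Q (N + k)"
    using Q v(1) by (auto simp: ideal_pow_add add.commute[of N] intro: ideal_prod.prod pow_mem_ideal_pow)
  moreover have "y [^] q = x \<otimes> (x [^] k \<otimes> v)"
    using v pc[OF v(1)] assms(1) by (simp add: k m_ac)
  ultimately have "y [^] Suc (N + k) \<in> x <# ideal_pow ?Q (N + k)"
    unfolding k by (auto simp: l_coset_def)
  then show ?thesis using assms False by (intro dominates_elem_if_monic)
qed

text \<open>Adjoining generators one at a time multiplies finitely many constants, so one constant
  serves the whole ideal.\<close>

lemma dominates_if_all_elem:
  assumes "ideal K R" "x \<in> carrier R" "\<And>y. y \<in> K \<Longrightarrow> dominates_elem x y"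
  shows "dominates x K"
  using assms(1)
proof (induct K rule: adjoin_induct)
  case zero
  show ?case using assms(2) by (rule dominates_zero)
next
  case (adjoin L b)
  then show ?case using assms ideal.Icarr[OF assms(1)] by (intro dominates_adjoin) auto
qed

end

section \<open>Colength\<close>

context cring
begin

text \<open>Every strictly ascending chain of ideals starting at \<open>K\<close> has at most \<open>k\<close> steps.\<close>

primrec colength_le :: "nat \<Rightarrow> 'a set \<Rightarrow> bool" where
  "colength_le 0 K \<longleftrightarrow> (\<forall>L. ideal L R \<longrightarrow> \<not> K \<subset> L)"
| "colength_le (Suc k) K \<longleftrightarrow> (\<forall>L. ideal L R \<longrightarrow> K \<subset> L \<longrightarrow> colength_le k L)"

lemma colength_leI:
  assumes "\<And>L. ideal L R \<Longrightarrow> K \<subset> L \<Longrightarrow> \<exists>j. k = Suc j \<and> colength_le j L"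
  shows "colength_le k K"
  using assms by (cases k) fastforce+

lemma colength_leD:
  assumes "colength_le k K" "ideal L R" "K \<subset> L"
  shows "\<exists>j. k = Suc j \<and> colength_le j L"
  using assms by (cases k) auto

lemma colength_le_mono:
  assumes "colength_le k K" "K \<subseteq> L"
  shows "colength_le k L"
  using assms by (intro colength_leI colength_leD[OF assms(1)]) auto

lemma colength_le_chain:
  assumes "colength_le k (D 0)" "\<And>i. ideal (D i) R" "\<And>i. i < m \<Longrightarrow> D i \<subset> D (Suc i)"
  shows "m \<le> k \<and> colength_le (k - m) (D m)"
  using assms(3)
proof (induct m)
  case 0
  then show ?case using assms(1) by simp
next
  case (Suc m)
  then have "m \<le> k" "colength_le (k - m) (D m)" "D m \<subset> D (Suc m)" by auto
  with colength_leD[OF _ assms(2)] obtain j where "k - m = Suc j" "colength_le j (D (Suc m))"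
    by blast
  then show ?case by (metis Suc_diff_Suc Suc_inject Suc_leI zero_less_Suc zero_less_diff)
qed

lemma adjoin_mono: "K \<subseteq> L \<Longrightarrow> adjoin K x \<subseteq> adjoin L x"
  unfolding mem_adjoin subset_iff by blast

text \<open>Additivity of length along R/(K : x) -> R/K -> R/(K + (x)), the first map being
  multiplication by x. A strict step from K enlarges (K : x) or K + (x), so one of the two bounds
  drops.\<close>

lemma colength_le_add:
  assumes "colength_le i (colon K x)" "colength_le j (adjoin K x)" "ideal K R" "x \<in> carrier R"
  shows "colength_le (i + j) K"
  using assms
proof (induct "i + j" arbitrary: i j K rule: less_induct)
  case less
  show ?case
  proof (rule colength_leI)
    fix L assume L: "ideal L R" "K \<subset> L"
    interpret K: ideal K R by fact
    interpret L: ideal L R by fact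
    have c: "colon K x \<subseteq> colon L x" using L by (auto simp: colon_def)
    have a: "adjoin K x \<subseteq> adjoin L x" using L by (intro adjoin_mono) auto
    have Lc: "ideal (colon L x) R" "ideal (adjoin L x) R"
      using L less.prems by (auto intro: colon_ideal adjoin_ideal)
    obtain d where d: "d \<in> L" "d \<notin> K" using L by auto
    \<comment> \<open>If neither grew, d = k + r x with k in K would give r x in L, hence r in (L :
      x) = (K : x) and d in K.\<close>
    have "colon K x \<noteq> colon L x \<or> adjoin K x \<noteq> adjoin L x"
    proof (rule ccontr)
      assume eq: "\<not> ?thesis"
      then have "d \<in> adjoin K x"
        using d adjoin_upper[OF L(1) less.prems(4)] by auto
      then obtain k r where kr: "k \<in> K" "r \<in> carrier R" "d = k \<oplus> r \<otimes> x"
        by (auto simp: mem_adjoin)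
      have kc: "k \<in> carrier R" "k \<in> L" using kr L by auto
      then have "x \<otimes> r = d \<ominus> k"
        using kr less.prems by algebra
      then have "x \<otimes> r \<in> L" using d kc by (auto simp: a_minus_def)
      then have "r \<in> colon K x" using eq kr by (auto simp: colon_def)
      then have "x \<otimes> r \<in> K" by (auto simp: colon_def)
      then have "d \<in> K" using kr less.prems by (auto simp: m_comm)
      with d show False by simp
    qed
    then consider "colon K x \<subset> colon L x" | "adjoin K x \<subset> adjoin L x" using c a by auto
    then show "\<exists>h. i + j = Suc h \<and> colength_le h L"
    proof cases
      case 1
      then obtain h where h: "i = Suc h" "colength_le h (colon L x)"
        using colength_leD[OF less.prems(1) Lc(1)] by auto
      then have "colength_le (h + j) L"
        using less.prems L a by (intro less.hyps) (auto intro: colength_le_mono)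
      then show ?thesis using h by auto
    next
      case 2
      then obtain h where h: "j = Suc h" "colength_le h (adjoin L x)"
        using colength_leD[OF less.prems(2) Lc(2)] by auto
      then have "colength_le (i + h) L"
        using less.prems L c by (intro less.hyps) (auto intro: colength_le_mono)
      then show ?thesis using h by auto
    qed
  qed
qed

lemma colength_le_carrier: "colength_le 0 (carrier R)"
  using ideal.Icarr by fastforce

lemma ideal_eq_carrier_if_unit:
  assumes "ideal L R" "v \<in> L" "v \<in> Units R"
  shows "L = carrier R"
proof -
  have "inv v \<otimes> v \<in> L" using assms by (intro ideal.I_l_closed) auto
  then show ?thesis using assms by (simp add: ideal.one_imp_carrier)
qed

lemma finprod_mem_ideal_pow:
  assumes "ideal Q R" "finite A" "\<And>i. i \<in> A \<Longrightarrow> l i \<in> Q"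
  shows "finprod R l A \<in> ideal_pow Q (card A)"
  using assms(2,3)
proof (induct A)
  case (insert i A)
  have lc: "l \<in> A \<rightarrow> carrier R" "l i \<in> carrier R"
    using insert.prems ideal.Icarr[OF assms(1)] by auto
  have "finprod R l A \<otimes> l i \<in> ideal_pow Q (Suc (card A))"
    using insert by (intro mult_mem_ideal_pow_Suc) auto
  then show ?case using insert lc by (simp add: m_comm)
qed simp

end

section \<open>Finite length over a one-dimensional local domain\<close>

locale one_dim_local_domain = noetherian_domain +
  fixes \<mm> :: "'a set"
  assumes max_ideal: "ideal \<mm> R"
    and max_proper: "\<mm> \<noteq> carrier R"
    and max_nonzero: "\<mm> \<noteq> {\<zero>}"
    and unit_if_not_mem: "v \<in> carrier R \<Longrightarrow> v \<notin> \<mm> \<Longrightarrow> v \<in> Units R"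
    and nonzero_prime_eq: "primeideal P R \<Longrightarrow> P \<noteq> {\<zero>} \<Longrightarrow> P = \<mm>"
begin

text \<open>If K is neither R nor prime, some product x y lies in K with x and y outside; then (K :
  x), which contains y, and K + (x) are both strictly larger. The only prime to treat is
  \<open>\<mm>\<close>.\<close>

lemma nonzero_ideal_induct [consumes 2, case_names carrier max step]:
  assumes "ideal K R" "K \<noteq> {\<zero>}" "P (carrier R)" "P \<mm>"
    and step: "\<And>K x. ideal K R \<Longrightarrow> x \<in> carrier R \<Longrightarrow> P (colon K x) \<Longrightarrow> P (adjoin K x) \<Longrightarrow> P K"
  shows "P K"
  using assms(1,2)
proof (induct K rule: noetherian_induct)
  case (less K)
  interpret K: ideal K R by fact
  consider "K = carrier R" | "primeideal K R"
    | x y where "x \<in> carrier R" "y \<in> carrier R" "x \<otimes> y \<in> K" "x \<notin> K" "y \<notin> K"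
    using K.primeidealCD[OF is_cring] by auto
  then show ?case
  proof cases
    case 3
    have "K \<subset> colon K x"
      using 3 subset_colon[OF less(1) 3(1)] by (auto simp: colon_def)
    moreover have "K \<subset> adjoin K x"
      using 3 adjoin_upper[OF less(1) 3(1)] by auto
    moreover have "ideal (colon K x) R" "ideal (adjoin K x) R"
      using 3 less(1) by (auto intro: colon_ideal adjoin_ideal)
    moreover have "L \<noteq> {\<zero>}" if "K \<subset> L" for L
      using that K.zero_closed by auto
    ultimately show ?thesis using step[OF less(1) 3(1)] less(2) by blast
  qed (use assms nonzero_prime_eq less.prems in auto)
qed

lemma finite_colength:
  assumes "ideal K R" "K \<noteq> {\<zero>}"
  shows "\<exists>k. colength_le k K"
  using assms
proof (induct K rule: nonzero_ideal_induct)
  case carrier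
  show ?case using colength_le_carrier by blast
next
  case max
  have "colength_le (Suc 0) \<mm>"
  proof (rule colength_leI)
    fix L assume L: "ideal L R" "\<mm> \<subset> L"
    then obtain v where "v \<in> L" "v \<notin> \<mm>" by auto
    then have "L = carrier R"
      using L ideal.Icarr[OF L(1)] unit_if_not_mem ideal_eq_carrier_if_unit by blast
    then show "\<exists>j. Suc 0 = Suc j \<and> colength_le j L" using colength_le_carrier by auto
  qed
  then show ?case by blast
next
  case (step K x)
  then show ?case using colength_le_add by blast
qed

text \<open>If t^i lies in (K : x) and t^j = k + r x with k in K, then t^i carries both summands
  into K, so t^(i+j) lies in K.\<close>

lemma pow_mem_nonzero_ideal:
  assumes "ideal K R" "K \<noteq> {\<zero>}" "t \<in> \<mm>"
  shows "\<exists>k::nat. t [^] k \<in> K"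
  using assms(1,2)
proof (induct K rule: nonzero_ideal_induct)
  have t: "t \<in> carrier R" using assms max_ideal ideal.Icarr by metis
  {
    case carrier
    show ?case using t by auto
  next
    case max
    show ?case using assms(3) t by (intro exI[of _ 1]) auto
  next
    case (step K x)
    interpret K: ideal K R by fact
    obtain i j :: nat where ij: "t [^] i \<in> colon K x" "t [^] j \<in> adjoin K x" using step by auto
    obtain k r where kr: "k \<in> K" "r \<in> carrier R" "t [^] j = k \<oplus> r \<otimes> x"
      using ij by (auto simp: mem_adjoin)
    have kc: "k \<in> carrier R" using kr by auto
    define s where "s = t [^] i"
    have s: "s \<in> carrier R" "x \<otimes> s \<in> K" using ij t by (auto simp: s_def colon_def)
    have "s \<otimes> (k \<oplus> r \<otimes> x) = s \<otimes> k \<oplus> r \<otimes> (x \<otimes> s)"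
      using s(1) kc kr(2) step(2) by algebra
    moreover have "s \<otimes> k \<oplus> r \<otimes> (x \<otimes> s) \<in> K"
      using s kr by (auto intro: K.I_l_closed)
    ultimately have "s \<otimes> t [^] j \<in> K" using kr by simp
    then show ?case using t by (auto simp: s_def nat_pow_mult)
  }
qed

text \<open>Since (tL : t) contains L and tL + (t) contains (t), the length of R / tL is at most
  that of R / L plus e, where e bounds the length of R / (t). A chain from tL that stays inside L
  leaves the length of R / L unspent, so it has at most e steps, whatever L is.\<close>

lemma uniform_chain_bound:
  assumes "t \<in> carrier R" "t \<noteq> \<zero>"
  shows "\<exists>e. \<forall>L D m. ideal L R \<longrightarrow> L \<noteq> {\<zero>} \<longrightarrow> D 0 = t <# L \<longrightarrow> (\<forall>i. ideal (D i) R) \<longrightarrow>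
    (\<forall>i<m. D i \<subset> D (Suc i)) \<longrightarrow> D m \<subseteq> L \<longrightarrow> m \<le> e"
proof -
  have "t \<in> PIdl t" using assms cgenideal_self by simp
  then obtain e where e: "colength_le e (PIdl t)"
    using assms finite_colength[of "PIdl t"] cgenideal_ideal by auto
  have "m \<le> e" if L: "ideal L R" "L \<noteq> {\<zero>}" and D: "D 0 = t <# L" "\<And>i. ideal (D i) R"
    "\<And>i. i < m \<Longrightarrow> D i \<subset> D (Suc i)" "D m \<subseteq> L" for L D m
  proof -
    have tL: "ideal (t <# L) R" using L assms by (intro l_coset_ideal) auto
    \<comment> \<open>The least bound is the exact length of R / L, which can be subtracted at the
      end.\<close>
    define s where "s = (LEAST s. colength_le s L)"
    have s: "colength_le s L" "\<And>k. colength_le k L \<Longrightarrow> s \<le> k"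
      unfolding s_def using finite_colength[OF L] by (auto intro: LeastI_ex Least_le)
    have "L \<subseteq> colon (t <# L) t"
      using ideal.Icarr[OF L(1)] by (auto simp: colon_def l_coset_def)
    then have 1: "colength_le s (colon (t <# L) t)"
      using s(1) colength_le_mono by blast
    have "PIdl t \<subseteq> adjoin (t <# L) t"
      using adjoin_upper[OF tL assms(1)] adjoin_ideal[OF tL assms(1)] by (intro cgenideal_minimal)
    then have "colength_le e (adjoin (t <# L) t)"
      using e colength_le_mono by blast
    with 1 have "colength_le (s + e) (D 0)"
      using colength_le_add tL assms(1) D(1) by simp
    then have m: "m \<le> s + e" "colength_le (s + e - m) (D m)"
      using colength_le_chain[of "s + e" D m] D by auto
    then have "s \<le> s + e - m" using D(4) colength_le_mono s(2) by blast
    with m(1) show ?thesis by linarith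
  qed
  then show ?thesis by blast
qed

end

section \<open>Dominating elements\<close>

text \<open>Substituting the inclusion into itself raises the power of t. In the application some
  t^k L lies in M, which leaves L inside M.\<close>

lemma (in cring) subset_pow_add_ideal:
  assumes "ideal L R" "ideal M R" "t \<in> carrier R" "L \<subseteq> set_add R (t <# L) M"
  shows "L \<subseteq> set_add R ((t [^] (k::nat)) <# L) M"
proof (induct k)
  interpret L: ideal L R by fact
  interpret M: ideal M R by fact
  {
    case 0
    show ?case
    proof
      fix z assume "z \<in> L"
      then have "z = (t [^] (0::nat) \<otimes> z) \<oplus> \<zero>" by simp
      with \<open>z \<in> L\<close> show "z \<in> set_add R ((t [^] (0::nat)) <# L) M"
        unfolding set_add_def' l_coset_def using M.zero_closed by blast
    qed
  next
    case (Suc k)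
    show ?case
    proof
      fix z assume "z \<in> L"
      then obtain w m where wm: "w \<in> L" "m \<in> M" "z = t [^] k \<otimes> w \<oplus> m"
        using Suc by (auto simp: set_add_def' l_coset_def)
      obtain w' m' where wm': "w' \<in> L" "m' \<in> M" "w = t \<otimes> w' \<oplus> m'"
        using wm(1) assms(4) by (auto simp: set_add_def' l_coset_def)
      define s where "s = t [^] k"
      have c: "w' \<in> carrier R" "m \<in> carrier R" "m' \<in> carrier R" "s \<in> carrier R"
        using wm wm' assms(3) by (auto simp: s_def)
      have "s \<otimes> (t \<otimes> w' \<oplus> m') \<oplus> m = (s \<otimes> t) \<otimes> w' \<oplus> (s \<otimes> m' \<oplus> m)"
        using c assms(3) by algebra
      then have "z = t [^] Suc k \<otimes> w' \<oplus> (s \<otimes> m' \<oplus> m)"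
        using wm(3) wm'(3) by (simp add: s_def)
      moreover have "s \<otimes> m' \<oplus> m \<in> M" using c wm wm' by (auto intro: M.I_l_closed)
      ultimately show "z \<in> set_add R ((t [^] Suc k) <# L) M"
        using wm'(1) unfolding set_add_def' l_coset_def by blast
    qed
  }
qed

text \<open>Modulo x each factor is a unit times b. The remainder is tracked as x times an element
  of the power one degree lower, which keeps the identity homogeneous.\<close>

lemma (in cring) finprod_linear_forms:
  assumes "ideal Q R" "x \<in> Q" "b \<in> Q" "finite A"
    and "\<And>i. i \<in> A \<Longrightarrow> d i \<in> Units R" "\<And>i. i \<in> A \<Longrightarrow> l i = x \<oplus> d i \<otimes> b"
  shows "\<exists>v\<in>Units R. \<exists>w\<in>ideal_pow Q (card A - 1). finprod R l A = v \<otimes> b [^] card A \<oplus> x \<otimes> w"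
  using assms(4-)
proof (induct A)
  case empty
  have "x \<in> carrier R" using assms ideal.Icarr by metis
  then show ?case by (intro bexI[of _ \<one>] bexI[of _ \<zero>]) auto
next
  case (insert i A)
  interpret Q: ideal Q R by fact
  let ?k = "card A"
  interpret Qk: ideal "ideal_pow Q ?k" R by (rule ideal_pow_ideal[OF assms(1)])
  obtain v w where vw: "v \<in> Units R" "w \<in> ideal_pow Q (?k - 1)"
    "finprod R l A = v \<otimes> b [^] ?k \<oplus> x \<otimes> w"
    using insert by auto
  have d: "d i \<in> Units R" "l i = x \<oplus> d i \<otimes> b" using insert by auto
  have c [simp]: "x \<in> carrier R" "b \<in> carrier R" "v \<in> carrier R" "d i \<in> carrier R" "w \<in> carrier R"
    using assms vw(1) d(1) ideal.Icarr[OF ideal_pow_ideal[OF assms(1)] vw(2)] by auto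
  have liQ: "l i \<in> Q" using d assms by (auto intro: Q.I_l_closed)
  have lc: "l \<in> A \<rightarrow> carrier R" "l i \<in> carrier R"
    using insert.prems(2) Units_closed[OF insert.prems(1)] by auto
  \<comment> \<open>For empty \<open>A\<close> truncated subtraction makes \<open>?k - 1\<close>
    equal to 0 as well, but then the target Q^0 is R.\<close>
  have "w \<otimes> l i \<in> ideal_pow Q ?k"
  proof (cases ?k)
    case 0
    then show ?thesis using lc by simp
  next
    case (Suc m)
    then show ?thesis using vw(2) liQ mult_mem_ideal_pow_Suc[of w Q m "l i"] by simp
  qed
  moreover have "v \<otimes> b [^] ?k \<in> ideal_pow Q ?k"
    using assms by (intro Qk.I_l_closed pow_mem_ideal_pow) auto
  ultimately have "v \<otimes> b [^] ?k \<oplus> w \<otimes> l i \<in> ideal_pow Q ?k" by simp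
  moreover have "finprod R l (insert i A) = (v \<otimes> d i) \<otimes> b [^] Suc ?k \<oplus> x \<otimes> (v \<otimes> b [^] ?k \<oplus> w \<otimes> l i)"
  proof -
    define y where "y = b [^] ?k"
    have y: "y \<in> carrier R" by (simp add: y_def)
    have "(x \<oplus> d i \<otimes> b) \<otimes> (v \<otimes> y \<oplus> x \<otimes> w) =
      (v \<otimes> d i) \<otimes> (y \<otimes> b) \<oplus> x \<otimes> (v \<otimes> y \<oplus> w \<otimes> (x \<oplus> d i \<otimes> b))"
      using y c by algebra
    moreover have "finprod R l (insert i A) = l i \<otimes> finprod R l A"
      using insert lc by simp
    ultimately show ?thesis using vw(3) d(2) by (simp add: y_def)
  qed
  ultimately show ?case
    using insert(1,2) vw(1) d(1) by (intro bexI[of _ "v \<otimes> d i"] bexI) auto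
qed

context one_dim_local_domain
begin

text \<open>The element is b if a is a multiple of b, and otherwise one of the forms a + u_i b,
  selected by a length count.\<close>

lemma pair_dominated:
  fixes u :: "nat \<Rightarrow> 'a"
  assumes u: "\<And>i. u i \<in> carrier R" "\<And>i j. i \<noteq> j \<Longrightarrow> u i \<ominus> u j \<notin> \<mm>"
    and ab: "a \<in> carrier R" "b \<in> carrier R"
  shows "\<exists>x\<in>adjoin (PIdl a) b. dominates_elem x a \<and> dominates_elem x b"
proof (cases "a \<in> PIdl b")
  case True
  then obtain r where r: "r \<in> carrier R" "a = r \<otimes> b" by (auto simp: cgenideal_def)
  have "b [^] n divides \<one> \<otimes> a [^] n" for n :: nat
    using r ab by (intro dividesI[of "r [^] n"]) (auto simp: nat_pow_distrib m_comm)
  then have "dominates_elem b a" unfolding dominates_elem_def by (intro bexI[of _ \<one>]) auto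
  moreover have "dominates_elem b b"
    unfolding dominates_elem_def using ab by (intro bexI[of _ \<one>]) auto
  ultimately show ?thesis using adjoin_cgenideal[OF ab] by blast
next
  case False
  define Q where "Q = adjoin (PIdl a) b"
  have Q: "ideal Q R" "a \<in> Q" "b \<in> Q"
    unfolding Q_def using adjoin_cgenideal[OF ab] by auto
  interpret Q: ideal Q R by (rule Q)
  note pc = ideal.Icarr[OF ideal_pow_ideal[OF Q(1)]]
  define l where "l i = a \<oplus> u i \<otimes> b" for i
  have lQ: "l i \<in> Q" for i using Q u by (auto simp: l_def intro: Q.I_l_closed)
  have lc: "l i \<in> carrier R" for i using lQ by auto
  \<comment> \<open>A vanishing form would put a into (b), the case settled above.\<close>
  have l0: "l i \<noteq> \<zero>" for i
  proof
    assume "l i = \<zero>"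
    moreover have "a = l i \<oplus> (\<ominus> u i) \<otimes> b"
      using ab u unfolding l_def by algebra
    ultimately have "a = (\<ominus> u i) \<otimes> b" using ab u by simp
    then show False using False u by (auto simp: cgenideal_def)
  qed
  obtain t where t: "t \<in> \<mm>" "t \<noteq> \<zero>"
    using max_nonzero additive_subgroup.zero_closed[OF ideal.axioms(1)[OF max_ideal]] by auto
  have tc: "t \<in> carrier R" using t max_ideal ideal.Icarr by metis
  obtain e where e: "\<And>L D m. ideal L R \<Longrightarrow> L \<noteq> {\<zero>} \<Longrightarrow> D 0 = t <# L \<Longrightarrow> (\<And>i. ideal (D i) R) \<Longrightarrow>
    (\<And>i. i < m \<Longrightarrow> D i \<subset> D (Suc i)) \<Longrightarrow> D m \<subseteq> L \<Longrightarrow> m \<le> e"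
    using uniform_chain_bound[OF tc t(2)] by blast
  \<comment> \<open>Degree e + 1 fits the products of all but one of e + 2 forms; e + 2 such
    products are too many to enlarge tL strictly each time.\<close>
  define L where "L = ideal_pow Q (Suc e)"
  have L: "ideal L R" unfolding L_def by (rule ideal_pow_ideal[OF Q(1)])
  interpret L: ideal L R by (rule L)
  have "a \<noteq> \<zero>" using False ab cgenideal_ideal[of b]
    by (auto simp: additive_subgroup.zero_closed ideal.axioms(1))
  then have L0: "L \<noteq> {\<zero>}"
    using pow_mem_ideal_pow[OF Q(1,2), of "Suc e"] pow_nonzero[OF ab(1), of "Suc e"]
    unfolding L_def by auto
  have tL: "ideal (t <# L) R" using L tc by (rule l_coset_ideal)
  define I where "I = {..Suc e}"
  define P where "P i = finprod R l (I - {i})" for i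
  have I: "finite I" "card I = Suc (Suc e)" by (auto simp: I_def)
  have PL: "P i \<in> L" if "i \<in> I" for i
    unfolding P_def L_def using finprod_mem_ideal_pow[OF Q(1), of "I - {i}" l] I lQ that by simp
  define D where "D = rec_nat (t <# L) (\<lambda>i K. adjoin K (P i))"
  have D_simps [simp]: "D 0 = t <# L" "D (Suc i) = adjoin (D i) (P i)" for i
    by (simp_all add: D_def)
  have Pc: "P i \<in> carrier R" for i unfolding P_def using lc by auto
  have D: "ideal (D i) R" for i
    by (induct i) (auto intro: tL adjoin_ideal Pc)
  have DL: "D i \<subseteq> L" if "i \<le> Suc (Suc e)" for i
    using that
  proof (induct i)
    case 0
    show ?case using tc by (auto simp: l_coset_def intro: L.I_l_closed)
  next
    case (Suc i)
    then show ?case using adjoin_least[OF L, of "D i" "P i"] PL[of i] by (simp add: I_def)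
  qed
  have "\<exists>j<Suc (Suc e). P j \<in> D j"
  proof (rule ccontr)
    assume neg: "\<not> ?thesis"
    have "D i \<subset> D (Suc i)" if "i < Suc (Suc e)" for i
      using adjoin_upper[OF D Pc, of i i] neg that by auto
    then have "Suc (Suc e) \<le> e" using e[OF L L0, of D "Suc (Suc e)"] D DL by (simp del: D_simps(2))
    then show False by simp
  qed
  then obtain j where j: "j < Suc (Suc e)" "P j \<in> D j" by blast
  \<comment> \<open>Every product other than \<open>P j\<close> has the factor \<open>l j\<close>
    and lies in \<open>M\<close>; so tL + M contains \<open>D j\<close> and with it
    \<open>P j\<close>.\<close>
  define M where "M = l j <# ideal_pow Q e"
  have M: "ideal M R" unfolding M_def using lc ideal_pow_ideal[OF Q(1)] by (intro l_coset_ideal)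
  interpret M: ideal M R by (rule M)
  define H where "H = set_add R (t <# L) M"
  have H: "ideal H R" unfolding H_def by (rule add_ideals[OF tL M])
  interpret H: ideal H R by (rule H)
  have tLH: "t <# L \<subseteq> H" and MH: "M \<subseteq> H"
  proof -
    have "\<zero> \<in> t <# L" using tL additive_subgroup.zero_closed ideal.axioms(1) by blast
    moreover have "z = \<zero> \<oplus> z" if "z \<in> M" for z using that by simp
    ultimately show "M \<subseteq> H" unfolding H_def set_add_def' by blast
    have "z = z \<oplus> \<zero>" if "z \<in> t <# L" for z using that ideal.Icarr[OF tL] by simp
    then show "t <# L \<subseteq> H" unfolding H_def set_add_def' using M.zero_closed by blast
  qed
  have PM: "P i \<in> M" if "i \<noteq> j" "i \<in> I" for i
  proof -
    have "P i = l j \<otimes> finprod R l (I - {i} - {j})"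
      unfolding P_def using that I j lc finprod_insert[of "I - {i} - {j}" j l]
      by (simp add: insert_absorb I_def insert_Diff)
    moreover have "finprod R l (I - {i} - {j}) \<in> ideal_pow Q e"
      using finprod_mem_ideal_pow[OF Q(1), of "I - {i} - {j}" l] I j lQ that
      by (simp add: I_def card_Diff_singleton_if)
    ultimately show ?thesis unfolding M_def by (auto simp: l_coset_def)
  qed
  have "D i \<subseteq> H" if "i \<le> j" for i
    using that
  proof (induct i)
    case 0
    show ?case using tLH by simp
  next
    case (Suc i)
    then show ?case using adjoin_least[OF H, of "D i" "P i"] PM[of i] MH j by (auto simp: I_def)
  qed
  then have PjH: "P j \<in> H" using j by auto
  \<comment> \<open>Modulo \<open>l j\<close> the other forms are \<open>u i \<ominus> u j\<close>
    times b, with unit coefficients because the \<open>u i\<close> are distinct modulo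
    \<open>\<mm>\<close>. So \<open>P j\<close> in \<open>H\<close> forces b^(e+1) into
    \<open>H\<close>.\<close>
  have "\<exists>v\<in>Units R. \<exists>w\<in>ideal_pow Q (card (I - {j}) - 1).
    finprod R l (I - {j}) = v \<otimes> b [^] card (I - {j}) \<oplus> l j \<otimes> w"
  proof (rule finprod_linear_forms[OF Q(1) lQ Q(3)])
    fix i assume "i \<in> I - {j}"
    then show "u i \<ominus> u j \<in> Units R" using u unit_if_not_mem by auto
    show "l i = l j \<oplus> (u i \<ominus> u j) \<otimes> b"
      using u ab unfolding l_def by algebra
  qed (use I in auto)
  then obtain v w where vw: "v \<in> Units R" "w \<in> ideal_pow Q e" "P j = v \<otimes> b [^] Suc e \<oplus> l j \<otimes> w"
    using I j by (auto simp: P_def I_def)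
  have "b [^] Suc e \<in> H"
  proof -
    define y where "y = b [^] Suc e"
    have c: "v \<in> carrier R" "y \<in> carrier R" "l j \<otimes> w \<in> carrier R"
      using vw ab lc pc by (auto simp: y_def)
    have "l j \<otimes> w \<in> H" using vw(2) MH by (auto simp: M_def l_coset_def)
    then have "P j \<ominus> l j \<otimes> w \<in> H" using PjH by (auto simp: a_minus_def)
    moreover have "P j \<ominus> l j \<otimes> w = v \<otimes> y"
      unfolding vw(3) y_def[symmetric] using c by algebra
    ultimately have "inv v \<otimes> (v \<otimes> y) \<in> H" using vw(1) by (auto intro: H.I_l_closed)
    then show ?thesis using vw(1) c by (simp add: m_assoc[symmetric] y_def)
  qed
  \<comment> \<open>\<open>l j\<close> replaces a as a generator of Q, so that Q^(e+1) lies in M +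
    (b^(e+1)).\<close>
  moreover have QQ: "Q = adjoin (PIdl (l j)) b"
  proof
    have A: "ideal (adjoin (PIdl (l j)) b) R" "l j \<in> adjoin (PIdl (l j)) b" "b \<in> adjoin (PIdl (l j)) b"
      using adjoin_cgenideal[OF lc ab(2)] by auto
    show "adjoin (PIdl (l j)) b \<subseteq> Q"
      using Q lQ by (intro adjoin_least cgenideal_minimal)
    have "a = l j \<oplus> (\<ominus> u j) \<otimes> b" using ab u unfolding l_def by algebra
    then have "a \<in> adjoin (PIdl (l j)) b"
      using A u by (metis a_inv_closed additive_subgroup.a_closed ideal.I_l_closed ideal.axioms(1))
    then show "Q \<subseteq> adjoin (PIdl (l j)) b"
      unfolding Q_def using A by (intro adjoin_least cgenideal_minimal)
  qed
  ultimately have "L \<subseteq> H"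
    using ideal_pow_adjoin_cgenideal[OF lc ab(2), of j e] adjoin_least[OF H MH]
    unfolding L_def M_def QQ[symmetric] by blast
  then have absorb: "L \<subseteq> set_add R ((t [^] k) <# L) M" for k :: nat
    unfolding H_def by (intro subset_pow_add_ideal L M tc)
  \<comment> \<open>Some t^k is a multiple of \<open>l j\<close>, so t^k L falls into
    \<open>M\<close> and the summand with t disappears.\<close>
  have "PIdl (l j) \<noteq> {\<zero>}" using cgenideal_self[OF lc] l0 by auto
  then obtain k :: nat where k: "t [^] k \<in> PIdl (l j)"
    using pow_mem_nonzero_ideal[OF cgenideal_ideal[OF lc] _ t(1)] by blast
  then obtain r where r: "r \<in> carrier R" "t [^] k = r \<otimes> l j" by (auto simp: cgenideal_def)
  have "L \<subseteq> M"
  proof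
    fix z assume "z \<in> L"
    then obtain w m where wm: "w \<in> L" "m \<in> M" "z = t [^] k \<otimes> w \<oplus> m"
      using absorb[of k] by (auto simp: set_add_def' l_coset_def)
    have "w \<in> ideal_pow Q e" using wm(1) ideal_pow_subset[OF Q(1)] by (auto simp: L_def)
    then have "l j \<otimes> w \<in> M" by (auto simp: M_def l_coset_def)
    then have "r \<otimes> (l j \<otimes> w) \<in> M" by (rule M.I_l_closed[OF _ r(1)])
    then show "z \<in> M" using wm r lc by (simp add: m_assoc)
  qed
  then have red: "ideal_pow Q (Suc e) \<subseteq> l j <# ideal_pow Q e" by (simp add: L_def M_def)
  show ?thesis
    unfolding Q_def[symmetric]
    using dominates_elem_if_principal_reduction[OF red Q(1) lQ l0] Q lQ by blast
qed

text \<open>Generators are adjoined one at a time: if x dominates K, an element z dominating both x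
  and b dominates K by transitivity and therefore K + (b).\<close>

lemma exists_dominating_element:
  fixes u :: "nat \<Rightarrow> 'a"
  assumes u: "\<And>i. u i \<in> carrier R" "\<And>i j. i \<noteq> j \<Longrightarrow> u i \<ominus> u j \<notin> \<mm>"
    and "ideal J R"
  shows "\<exists>x\<in>J. dominates x J"
  using assms(3)
proof (induct J rule: adjoin_induct)
  case zero
  show ?case using dominates_zero by simp
next
  case (adjoin K b)
  interpret K: ideal K R by fact
  obtain x where x: "x \<in> K" "dominates x K" using adjoin by auto
  have c: "x \<in> carrier R" "b \<in> carrier R"
    using x adjoin ideal.Icarr[OF assms(3)] by auto
  obtain z where z: "z \<in> adjoin (PIdl x) b" "dominates_elem z x" "dominates_elem z b"
    using pair_dominated[of u, OF u c] by blast
  have zK: "z \<in> adjoin K b"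
    using z(1) adjoin_mono[OF cgenideal_minimal[OF adjoin(1) x(1)]] by blast
  have zc: "z \<in> carrier R" by (rule ideal.Icarr[OF adjoin_ideal[OF adjoin(1) c(2)] zK])
  have "dominates z K" by (rule dominates_trans[OF x(2) z(2) adjoin(1) c(1) zc])
  then have "dominates z (adjoin K b)" by (rule dominates_adjoin[OF _ z(3) adjoin(1) zc c(2)])
  with zK show ?case by blast
qed

end

section \<open>Reductions and tight closure\<close>

lemma (in noetherian_ring) exists_maximalideal:
  assumes "ideal K R" "K \<noteq> carrier R"
  shows "\<exists>M. maximalideal M R \<and> K \<subseteq> M"
proof -
  let ?S = "{L. ideal L R \<and> K \<subseteq> L \<and> L \<noteq> carrier R}"
  have "\<exists>M\<in>?S. \<forall>L\<in>?S. M \<subseteq> L \<longrightarrow> L = M"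
    using assms by (intro exists_maximal_ideal_in) auto
  then obtain M where M: "M \<in> ?S" "\<forall>L\<in>?S. M \<subseteq> L \<longrightarrow> L = M" by blast
  then have "maximalideal M R" by (intro maximalidealI) auto
  with M show ?thesis by auto
qed

text \<open>Dimension at least one makes the maximal ideal nonzero; dimension at most one excludes a
  prime strictly between 0 and it.\<close>

lemma one_dim_local_domainI:
  fixes R (structure)
  assumes "local_ring R" "domain R" "krull_dim R = 1"
  shows "one_dim_local_domain R (THE m. maximalideal m R)"
proof -
  interpret local_ring R by fact
  interpret domain R by fact
  interpret noetherian_domain R by unfold_locales
  define m where "m = (THE m. maximalideal m R)"
  have m: "maximalideal m R" unfolding m_def using unique_maximal by (rule theI')
  interpret m: maximalideal m R by (rule m)
  have sub: "K \<subseteq> m" if "ideal K R" "K \<noteq> carrier R" for K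
    using exists_maximalideal[OF that] unique_maximal m by blast
  have dim: "n \<le> 1" if "\<forall>i\<le>n. primeideal (P i) R" "\<forall>i<n. P i \<subset> P (Suc i)" for P and n :: nat
  proof -
    have "enat n \<le> krull_dim R"
      unfolding krull_dim_def using that by (intro Sup_upper) auto
    then show ?thesis using assms(3) by (simp add: one_enat_def)
  qed
  have proper: "P \<noteq> carrier R" "ideal P R" "\<zero> \<in> P" if "primeideal P R" for P
  proof -
    interpret P: primeideal P R by fact
    show "P \<noteq> carrier R" "ideal P R" "\<zero> \<in> P"
      using P.I_notcarr by (auto simp: P.is_ideal)
  qed
  have "one_dim_local_domain R m"
  proof
    show "m \<noteq> carrier R" using m.I_notcarr by simp
    show "m \<noteq> {\<zero>}"
    proof
      assume m0: "m = {\<zero>}"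
      have P0: "P = {\<zero>}" if "primeideal P R" for P
        using proper[OF that] sub[of P] m0 by auto
      have "n = 0" if "\<forall>i\<le>n. primeideal (P i) R" "\<forall>i<n. P i \<subset> P (Suc i)" for P and n :: nat
      proof (rule ccontr)
        assume "n \<noteq> 0"
        then have "P 0 \<subset> P (Suc 0)" "primeideal (P 0) R" "primeideal (P (Suc 0)) R"
          using that by auto
        then show False using P0[of "P 0"] P0[of "P (Suc 0)"] by auto
      qed
      then have "krull_dim R \<le> 0"
        unfolding krull_dim_def by (intro Sup_least) (auto simp: zero_enat_def)
      then show False using assms(3) by simp
    qed
    show "v \<in> Units R" if v: "v \<in> carrier R" "v \<notin> m" for v
    proof -
      have "PIdl v = carrier R"
        using sub[OF cgenideal_ideal[OF v(1)]] cgenideal_self[OF v(1)] v(2) by blast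
      then have "\<one> \<in> PIdl v" by simp
      then obtain r where "r \<in> carrier R" "\<one> = r \<otimes> v" by (auto simp: cgenideal_def)
      then show ?thesis using v(1) by (auto simp: Units_def m_comm)
    qed
    show "P = m" if P: "primeideal P R" "P \<noteq> {\<zero>}" for P
    proof (rule ccontr)
      assume "P \<noteq> m"
      then have lt: "P \<subset> m" using sub proper[OF P(1)] by auto
      have z: "{\<zero>} \<subset> P" using proper[OF P(1)] P(2) by auto
      define C where "C = (\<lambda>i::nat. if i = 0 then {\<zero>} else if i = 1 then P else m)"
      have "2 \<le> (1::nat)"
      proof (rule dim[of 2 C])
        show "\<forall>i\<le>2. primeideal (C i) R"
          using P(1) zeroprimeideal maximalideal_prime[OF m] by (auto simp: C_def)
        show "\<forall>i<2. C i \<subset> C (Suc i)"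
          using lt z by (auto simp: C_def less_Suc_eq numeral_2_eq_2)
      qed
      then show False by simp
    qed
  qed
  then show ?thesis by (simp add: m_def)
qed

text \<open>The zero ideal is prime and lies in every prime, so it is the only minimal one.\<close>

lemma (in domain) off_minimal_primes_eq: "off_minimal_primes R = carrier R - {\<zero>}"
proof -
  have z: "\<zero> \<in> P" if "primeideal P R" for P
    using that by (meson additive_subgroup.zero_closed ideal.axioms(1) primeideal.axioms(1))
  have "minimal_prime P R \<longleftrightarrow> P = {\<zero>}" for P
    unfolding minimal_prime_def using z zeroprimeideal by blast
  then show ?thesis by (simp add: off_minimal_primes_def)
qed

section \<open>Bracket powers and powers of a reduction\<close>

context cring
begin

lemma bracket_power_ideal:
  assumes "J \<subseteq> carrier R"
  shows "ideal (bracket_power R J q) R"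
  unfolding bracket_power_def using assms by (intro genideal_ideal) auto

lemma pow_mem_bracket_power:
  assumes "J \<subseteq> carrier R" "x \<in> J"
  shows "x [^] q \<in> bracket_power R J q"
proof -
  have "(\<lambda>x. x [^] q) ` J \<subseteq> bracket_power R J q"
    unfolding bracket_power_def using assms(1) by (intro genideal_self) auto
  with assms(2) show ?thesis by auto
qed

text \<open>The z for which x^q divides c z form an ideal, so it is enough to check the generators
  a^q.\<close>

lemma divides_of_bracket_power:
  assumes "ideal J R" "x \<in> carrier R" "c \<in> carrier R"
    and "\<And>a. a \<in> J \<Longrightarrow> x [^] (q::nat) divides c \<otimes> a [^] q"
    and "z \<in> bracket_power R J q"
  shows "x [^] q divides c \<otimes> z"
proof -
  have "ideal {z \<in> carrier R. x [^] q divides c \<otimes> z} R"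
  proof (rule ideal_Collect)
    fix a r assume "a \<in> carrier R" "r \<in> carrier R" "x [^] q divides c \<otimes> a"
    then show "x [^] q divides c \<otimes> (r \<otimes> a)"
      using divides_mult_right[of "x [^] q" r "c \<otimes> a"] assms(2,3) by (simp add: m_ac)
  qed (use assms(2,3) in \<open>simp_all add: divides_zero r_distr divides_add\<close>)
  then have "bracket_power R J q \<subseteq> {z \<in> carrier R. x [^] q divides c \<otimes> z}"
    unfolding bracket_power_def using assms(4) ideal.Icarr[OF assms(1)]
    by (intro genideal_minimal) auto
  with assms(5) show ?thesis by auto
qed

lemma reduction_iff_ideal_pow:
  "reduction R I J \<longleftrightarrow> ideal J R \<and> J \<subseteq> I \<and>
    (\<exists>n. J \<cdot> ideal_pow I n = ideal_pow I (Suc n))"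
  by (simp add: reduction_def ideal_pow_def)

text \<open>Trading one factor I at a time for J gives I^(n+q) = J^q I^n.\<close>

lemma reduction_ideal_pow:
  assumes "ideal I R" "ideal J R" "J \<cdot> ideal_pow I n = ideal_pow I (Suc n)"
  shows "ideal_pow I (n + q) \<subseteq> ideal_pow J q"
proof -
  note P = ideal_pow_ideal[OF assms(1)] ideal_pow_ideal[OF assms(2)]
  have "ideal_pow I (n + q) = ideal_pow J q \<cdot> ideal_pow I n"
  proof (induct q)
    case 0
    show ?case
      using ideal_prod_commute[OF oneideal P(1)] by (simp add: ideal_prod_one P)
  next
    case (Suc q)
    then have "ideal_pow I (n + Suc q) = (ideal_pow J q \<cdot> ideal_pow I n) \<cdot> I"
      by (simp add: ideal_pow_Suc)
    also have "\<dots> = ideal_pow J q \<cdot> (J \<cdot> ideal_pow I n)"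
      using assms P by (simp add: ideal_prod_assoc ideal_pow_Suc)
    also have "\<dots> = ideal_pow J (Suc q) \<cdot> ideal_pow I n"
      using assms P by (simp add: ideal_prod_assoc ideal_pow_Suc)
    finally show ?case .
  qed
  then show ?thesis using ideal_prod_inter[OF P(2) P(1)] by auto
qed

end

section \<open>Comparison of reductions with tight closure\<close>

context noetherian_domain
begin

text \<open>For y nonzero the multiplier is c y^n: the reduction equation puts y^(n+q) into J^q, so
  c y^(n+q) is a multiple of x^q, which lies in the bracket power.\<close>

lemma subset_tight_closure_if_reduction:
  assumes "ideal I R" "reduction R I J" "x \<in> J" "dominates x J" "p > 0"
  shows "I \<subseteq> tight_closure R p J"
proof
  fix y assume y: "y \<in> I"
  obtain n where J: "ideal J R" and n: "J \<cdot> ideal_pow I n = ideal_pow I (Suc n)"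
    using assms(2) by (auto simp: reduction_iff_ideal_pow)
  interpret J: ideal J R by (rule J)
  have B: "ideal (bracket_power R J q) R" for q by (rule bracket_power_ideal) auto
  have yc: "y \<in> carrier R" using y ideal.Icarr[OF assms(1)] by auto
  have xc: "x \<in> carrier R" using assms(3) by simp
  show "y \<in> tight_closure R p J"
  proof (cases "y = \<zero>")
    case True
    \<comment> \<open>For y = 0 the multiplier c y^n could vanish, so 1 is taken; p > 0 keeps the
      exponent positive, hence the power zero.\<close>
    have "\<one> \<otimes> y [^] (p ^ e) \<in> bracket_power R J (p ^ e)" for e
      using True assms(5) additive_subgroup.zero_closed[OF ideal.axioms(1)[OF B]]
      by (simp add: nat_pow_zero)
    then show ?thesis
      unfolding tight_closure_def off_minimal_primes_eq using yc
      by (intro CollectI conjI bexI[of _ \<one>] exI[of _ 0]) auto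
  next
    case False
    obtain c where c: "c \<in> carrier R" "c \<noteq> \<zero>"
      "\<And>n w. w \<in> ideal_pow J n \<Longrightarrow> x [^] n divides c \<otimes> w"
      using assms(4) by (auto simp: dominates_def)
    have "(c \<otimes> y [^] n) \<otimes> y [^] q \<in> bracket_power R J q" for q :: nat
    proof -
      have "y [^] (n + q) \<in> ideal_pow J q"
        using reduction_ideal_pow[OF assms(1) J n] pow_mem_ideal_pow[OF assms(1) y] by blast
      then have "x [^] q divides c \<otimes> y [^] (n + q)" by (rule c(3))
      then obtain r where r: "r \<in> carrier R" "c \<otimes> y [^] (n + q) = x [^] q \<otimes> r"
        by (auto simp: factor_def)
      have "x [^] q \<otimes> r \<in> bracket_power R J q"
        using r(1) assms(3) by (intro ideal.I_r_closed[OF B] pow_mem_bracket_power) auto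
      then show ?thesis
        using r(2) c(1) yc by (simp add: m_assoc nat_pow_mult)
    qed
    then show ?thesis
      unfolding tight_closure_def off_minimal_primes_eq
      using yc c False pow_nonzero[OF yc False]
      by (intro CollectI conjI bexI[of _ "c \<otimes> y [^] n"] exI[of _ 0]) (auto simp: integral_iff)
  qed
qed

text \<open>With d from tight closure and c from domination, c d y^q lies in (x^q) for unboundedly
  many q, so x dominates I. The resulting inclusion of I^(n+1) in x I^n passes through J I^n because
  x lies in J.\<close>

lemma reduction_if_subset_tight_closure:
  assumes "ideal I R" "ideal J R" "J \<subseteq> I" "I \<subseteq> tight_closure R p J"
    and "x \<in> J" "dominates x J" "p > 1"
  shows "reduction R I J"
proof -
  have xc: "x \<in> carrier R" using assms(2,5) ideal.Icarr by metis
  obtain c where c: "c \<in> carrier R" "c \<noteq> \<zero>"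
    "\<And>n w. w \<in> ideal_pow J n \<Longrightarrow> x [^] n divides c \<otimes> w"
    using assms(6) by (auto simp: dominates_def)
  have "dominates_elem x y" if y: "y \<in> I" for y
  proof -
    have "y \<in> tight_closure R p J" using assms(4) y by blast
    then obtain d e\<^sub>0 where d: "y \<in> carrier R" "d \<in> carrier R" "d \<noteq> \<zero>"
      "\<And>e. e \<ge> e\<^sub>0 \<Longrightarrow> d \<otimes> y [^] (p ^ e) \<in> bracket_power R J (p ^ e)"
      by (auto simp: tight_closure_def off_minimal_primes_eq)
    show ?thesis
    proof (rule dominates_elem_if_frequently)
      show "\<exists>q>N. x [^] q divides (c \<otimes> d) \<otimes> y [^] q" for N :: nat
      proof (intro exI conjI)
        \<comment> \<open>This exponent is at least \<open>e\<^sub>0\<close>, and since p > 1 its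
          power of p exceeds \<open>N\<close>.\<close>
        let ?e = "max e\<^sub>0 N"
        have "?e < p ^ ?e" using assms(7) by (intro power_gt_expt) auto
        then show "N < p ^ ?e" by linarith
        have "x [^] (p ^ ?e) divides c \<otimes> a [^] (p ^ ?e)" if "a \<in> J" for a
          by (rule c(3)[OF pow_mem_ideal_pow[OF assms(2) that]])
        then have "x [^] (p ^ ?e) divides c \<otimes> (d \<otimes> y [^] (p ^ ?e))"
          by (rule divides_of_bracket_power[OF assms(2) xc c(1) _ d(4)]) auto
        then show "x [^] (p ^ ?e) divides (c \<otimes> d) \<otimes> y [^] (p ^ ?e)"
          using c(1) d(1,2) by (simp add: m_assoc)
      qed
    qed (use c d xc in \<open>auto simp: integral_iff\<close>)
  qed
  then have "dominates x I" by (rule dominates_if_all_elem[OF assms(1) xc])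
  then obtain n where n: "ideal_pow I (Suc n) \<subseteq> x <# ideal_pow I n"
    using dominates_imp_principal_reduction assms by blast
  have "x <# ideal_pow I n \<subseteq> J \<cdot> ideal_pow I n"
    using assms(5) by (auto simp: l_coset_def intro: ideal_prod.prod)
  moreover have "J \<cdot> ideal_pow I n \<subseteq> ideal_pow I (Suc n)"
    unfolding ideal_pow_Suc ideal_prod_commute[OF assms(2) ideal_pow_ideal[OF assms(1)]]
    by (rule ideal_prod_mono[OF ideal_pow_ideal[OF assms(1)] assms(1) subset_refl assms(3)])
  ultimately have "J \<cdot> ideal_pow I n = ideal_pow I (Suc n)" using n by blast
  then show ?thesis using assms(2,3) by (auto simp: reduction_iff_ideal_pow)
qed

text \<open>Characteristic 1 would mean 1 = 0. Together with p > 0 this gives p > 1, so the powers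
  of p are unbounded.\<close>

lemma char_ring_neq_1: "char_ring R \<noteq> 1"
proof
  let ?P = "\<lambda>n::nat. n > 0 \<and> add_pow R n \<one> = \<zero>"
  assume *: "char_ring R = 1"
  then have "\<exists>n. ?P n" by (auto simp: char_ring_def split: if_splits)
  moreover from this have "(LEAST n. ?P n) = 1" using * by (auto simp: char_ring_def)
  ultimately have "?P 1" using LeastI_ex[of ?P] by simp
  then show False by (simp add: add_pow_def)
qed

end

text \<open>Representatives of an injective sequence of cosets. They supply the coefficients of the
  linear forms; their differences are units when \<open>K\<close> is the maximal ideal of a local
  ring.\<close>

lemma (in ring) infinite_quotient_representatives:
  assumes "ideal K R" "infinite (carrier (R Quot K))"
  obtains u :: "nat \<Rightarrow> 'a"
  where "\<And>i. u i \<in> carrier R" "\<And>i j. i \<noteq> j \<Longrightarrow> u i \<ominus> u j \<notin> K"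
proof -
  obtain f :: "nat \<Rightarrow> 'a set" where f: "inj f" "range f \<subseteq> carrier (R Quot K)"
    using infinite_countable_subset[OF assms(2)] by blast
  have "\<exists>a\<in>carrier R. f i = K +> a" for i
    using f(2) by (auto simp: FactRing_def A_RCOSETS_def')
  then obtain u where u: "\<And>i. u i \<in> carrier R" "\<And>i. f i = K +> u i" by metis
  have "u i \<ominus> u j \<notin> K" if "i \<noteq> j" for i j
    using quotient_eq_iff_same_a_r_cos[OF assms(1) u(1) u(1), of i j] u(2) f(1) that
    by (metis injD)
  then show ?thesis using that u(1) by blast
qed

theorem proposition4p2:
  fixes R :: "('a, 'b) ring_scheme" and I :: "'a set" and p :: nat
  assumes "local_ring R" and "domain R" and "krull_dim R = 1"
    and "char_ring R = p" and "p > 0"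
    and "infinite (carrier (residue_field R))"
    and "ideal I R"
  shows "star_core R p I = core R I"
proof -
  interpret one_dim_local_domain R "THE m. maximalideal m R"
    using assms(1-3) by (rule one_dim_local_domainI)
  have p: "p > 1" using assms(4,5) char_ring_neq_1 by linarith
  obtain u :: "nat \<Rightarrow> 'a" where u: "\<And>i. u i \<in> carrier R"
    "\<And>i j. i \<noteq> j \<Longrightarrow> u i \<ominus>\<^bsub>R\<^esub> u j \<notin> (THE m. maximalideal m R)"
    using infinite_quotient_representatives[OF max_ideal] assms(6)
    unfolding residue_field_def by blast
  \<comment> \<open>One dominating element of \<open>J\<close> serves both directions; equal
    families of ideals have equal intersections.\<close>
  have "star_reduction R p I J \<longleftrightarrow> reduction R I J" for J
  proof (cases "ideal J R \<and> J \<subseteq> I")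
    case True
    then obtain x where "x \<in> J" "dominates x J"
      using exists_dominating_element[of u, OF u] by blast
    then show ?thesis
      using True subset_tight_closure_if_reduction[OF assms(7) _ _ _ assms(5)]
        reduction_if_subset_tight_closure[OF assms(7) _ _ _ _ _ p]
      by (auto simp: star_reduction_def)
  next
    case False
    then show ?thesis by (auto simp: star_reduction_def reduction_def)
  qed
  then show ?thesis by (simp add: star_core_def core_def)
qed

end
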